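(* Let $p\in[1,\infty)$. The $p$-Choquet decomposable hull of a nonempty convex subset of $L^p(E)$ is a Choquet set in $V=L^p(E)$. Moreover, for every nonempty $A\subseteq L^p(E)$, \[ \operatorname{chd}_p\operatorname{ch}A=\operatorname{chd}_p\operatorname{conv}A=L^p(\overline{\operatorname{conv}}F_A)=\overline{\operatorname{conv}}\,L^p(F_A)=\overline{\operatorname{conv}}\operatorname{chd}_pA=\operatorname{cl}_p\operatorname{conv}\operatorname{dec}A=\operatorname{cl}_p\operatorname{dec}\operatorname{conv}A . \]
   Context: $E$ is a separable Banach space with dual $E^*$; $(\Omega,\mathcal F,\mathbb P)$ a complete probability space; $L^p(E)$ the Banach space of a.s.-classes of $E$-valued random variables with $\mathbb E|\xi|^p<\infty$. $\operatorname{cl}_p$ is norm closure in $L^p(E)$; $\overline{\operatorname{conv}}B=\operatorname{cl}_p\operatorname{conv}B$ for $B\subseteq L^p(E)$, while for a multifunction $X$, $\overline{\operatorname{conv}}X$ is the pointwise closed convex hull $\omega\mapsto\overline{\operatorname{conv}}X(\omega)$. $\operatorname{dec}A$: all finite decompositions $\sum_{i=1}^m1_{B_i}\xi_i$, $\xi_i\in A$, $(B_i)$ a measurable partition of $\Omega$. $L^p(X)=\{\xi\in L^p(E):\xi(\omega)\in X(\omega)\text{ a.s.}\}$. For nonempty $A\subseteq L^p(E)$, $F_A$ is the a.s. unique closed Effros measurable multifunction with $\operatorname{cl}_p\operatorname{dec}A=L^p(F_A)$. Kernels: a transition probability kernel $K$ from $(\Omega,\mathcal F)$ to $(E,\mathcal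 B(E))$ has barycenter $r(K)=Y\in L^p(E)$ if $L\circ Y=\int_EL(x)K(\cdot,dx)$ a.s. for all $L\in E^*$; $\mathcal K^\delta_p(A)$ is the set of regular Borel transition probability kernels $K$ with $K(\omega,F_A(\omega))=1$ a.s., having barycenter in $L^p(E)$, and $K(\omega)$ Dirac a.s.; $B$ is $p$-Choquet decomposable if $r(K)\in B$ for all $K\in\mathcal K^\delta_p(B)$; $\operatorname{chd}_pA$ is the smallest $p$-Choquet decomposable subset of $L^p(E)$ containing $A$. Choquet hull in $V=L^p(E)$: a Borel probability measure $\mu$ on $V$ has barycenter $r(\mu)=y$ if $\ell(y)=\int_V\ell\,d\mu$ for all $\ell\in V^*$; $\mathcal M(B)$ (for Borel $B$) is the set of regular Borel probability measures with $\mu(B)=1$ having a barycenter, and for arbitrary $B$, $\mathcal M(B)=\bigcup\{\mathcal M(C):C\subseteq B\text{ Borel}\}$; $B$ is a Choquet set if $r(\mu)\in B$ for all $\mu\in\mathcal M(B)$; $\operatorname{ch}B$ is the smallest Choquet set containing $B$. *)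

theory Defs
  imports "HOL-Probability.Probability"
begin

text \<open>Representation: an element of L^p(E) (an a.s.-class) is represented by any
  of its representatives f :: 'a \<Rightarrow> 'e; a subset of L^p(E) is represented by the
  saturated set of all representatives of its elements (see Lp_sets).\<close>

definition Lp :: "'a measure \<Rightarrow> real \<Rightarrow> ('a \<Rightarrow> 'e::{banach,second_countable_topology}) set" where
  "Lp M p = {f. f \<in> borel_measurable M \<and> integrable M (\<lambda>w. norm (f w) powr p)}"

definition Lp_norm :: "'a measure \<Rightarrow> real \<Rightarrow> ('a \<Rightarrow> 'e::{banach,second_countable_topology}) \<Rightarrow> real" where
  "Lp_norm M p f = (\<integral>w. norm (f w) powr p \<partial>M) powr (1 / p)"

definition Lp_dist :: "'a measure \<Rightarrow> real \<Rightarrow> ('a \<Rightarrow> 'e::{banach,second_countable_topology}) \<Rightarrow> ('a \<Rightarrow> 'e) \<Rightarrow> real" where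
  "Lp_dist M p f g = Lp_norm M p (\<lambda>w. f w - g w)"

text \<open>Saturated (a.s.-closed) subsets of Lp: these represent subsets of L^p(E).\<close>
definition ae_closed :: "'a measure \<Rightarrow> real \<Rightarrow> ('a \<Rightarrow> 'e::{banach,second_countable_topology}) set \<Rightarrow> bool" where
  "ae_closed M p B \<longleftrightarrow> (\<forall>f\<in>B. \<forall>g\<in>Lp M p. (AE w in M. f w = g w) \<longrightarrow> g \<in> B)"

definition Lp_sets :: "'a measure \<Rightarrow> real \<Rightarrow> ('a \<Rightarrow> 'e::{banach,second_countable_topology}) set set" where
  "Lp_sets M p = {B. B \<subseteq> Lp M p \<and> ae_closed M p B}"

definition Lp_top :: "'a measure \<Rightarrow> real \<Rightarrow> ('a \<Rightarrow> 'e::{banach,second_countable_topology}) topology" where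
  "Lp_top M p = topology (\<lambda>U. U \<subseteq> Lp M p \<and>
      (\<forall>f\<in>U. \<exists>e>0. \<forall>g\<in>Lp M p. Lp_dist M p f g < e \<longrightarrow> g \<in> U))"

definition Lp_cl :: "'a measure \<Rightarrow> real \<Rightarrow> ('a \<Rightarrow> 'e::{banach,second_countable_topology}) set \<Rightarrow> ('a \<Rightarrow> 'e) set" where
  "Lp_cl M p B = Lp_top M p closure_of B"

definition Lp_conv :: "('a \<Rightarrow> 'e::real_vector) set \<Rightarrow> ('a \<Rightarrow> 'e) set" where
  "Lp_conv A = {(\<lambda>w. \<Sum>i\<in>I. c i *\<^sub>R f i w) | (I :: nat set) c f.
      finite I \<and> I \<noteq> {} \<and> (\<forall>i\<in>I. 0 \<le> c i \<and> f i \<in> A) \<and> sum c I = 1}"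

definition Lp_convex :: "('a \<Rightarrow> 'e::real_vector) set \<Rightarrow> bool" where
  "Lp_convex C \<longleftrightarrow> (\<forall>f\<in>C. \<forall>g\<in>C. \<forall>t::real. 0 \<le> t \<and> t \<le> 1 \<longrightarrow>
      (\<lambda>w. t *\<^sub>R f w + (1 - t) *\<^sub>R g w) \<in> C)"

definition Lp_dec :: "'a measure \<Rightarrow> ('a \<Rightarrow> 'e::real_vector) set \<Rightarrow> ('a \<Rightarrow> 'e) set" where
  "Lp_dec M A = {(\<lambda>w. \<Sum>i<m. indicator (B i) w *\<^sub>R \<xi> i w) | (m::nat) B \<xi>.
      (\<forall>i<m. B i \<in> sets M \<and> \<xi> i \<in> A) \<and> disjoint_family_on B {..<m} \<and>
      (\<Union>i<m. B i) = space M}"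

definition Lp_sel :: "'a measure \<Rightarrow> real \<Rightarrow> ('a \<Rightarrow> 'e::{banach,second_countable_topology} set) \<Rightarrow> ('a \<Rightarrow> 'e) set" where
  "Lp_sel M p X = {f \<in> Lp M p. AE w in M. f w \<in> X w}"

definition effros_closed :: "'a measure \<Rightarrow> ('a \<Rightarrow> 'e::{banach,second_countable_topology} set) \<Rightarrow> bool" where
  "effros_closed M X \<longleftrightarrow> (\<forall>w\<in>space M. closed (X w)) \<and>
      (\<forall>U. open U \<longrightarrow> {w \<in> space M. X w \<inter> U \<noteq> {}} \<in> sets M)"

text \<open>F_A (a.s. unique; any choice).\<close>
definition F_of :: "'a measure \<Rightarrow> real \<Rightarrow> ('a \<Rightarrow> 'e::{banach,second_countable_topology}) set \<Rightarrow> 'a \<Rightarrow> 'e set" where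
  "F_of M p A = (SOME X. effros_closed M X \<and> Lp_cl M p (Lp_dec M A) = Lp_sel M p X)"

definition regular_borel_E :: "'e::{banach,second_countable_topology} measure \<Rightarrow> bool" where
  "regular_borel_E N \<longleftrightarrow> (\<forall>B\<in>sets borel.
      emeasure N B = (SUP C\<in>{C. compact C \<and> C \<subseteq> B}. emeasure N C))"

definition trans_kernel :: "'a measure \<Rightarrow> ('a \<Rightarrow> 'e::{banach,second_countable_topology} measure) \<Rightarrow> bool" where
  "trans_kernel M K \<longleftrightarrow>
     (\<forall>w\<in>space M. sets (K w) = sets borel \<and> prob_space (K w) \<and> regular_borel_E (K w)) \<and>
     (\<forall>B\<in>sets borel. (\<lambda>w. emeasure (K w) B) \<in> borel_measurable M)"

definition kernel_bary :: "'a measure \<Rightarrow> ('a \<Rightarrow> 'e::{banach,second_countable_topology} measure) \<Rightarrow> ('a \<Rightarrow> 'e) \<Rightarrow> bool" where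
  "kernel_bary M K Y \<longleftrightarrow> Y \<in> borel_measurable M \<and>
     (\<forall>L :: 'e \<Rightarrow> real. bounded_linear L \<longrightarrow>
        (AE w in M. integrable (K w) L \<and> L (Y w) = (\<integral>x. L x \<partial>K w)))"

definition Kdelta :: "'a measure \<Rightarrow> real \<Rightarrow> ('a \<Rightarrow> 'e::{banach,second_countable_topology}) set \<Rightarrow> ('a \<Rightarrow> 'e measure) set" where
  "Kdelta M p A = {K. trans_kernel M K \<and>
      (AE w in M. emeasure (K w) (F_of M p A w) = 1) \<and>
      (\<exists>Y\<in>Lp M p. kernel_bary M K Y) \<and>
      (AE w in M. \<exists>x. K w = return borel x)}"

definition p_choquet_dec :: "'a measure \<Rightarrow> real \<Rightarrow> ('a \<Rightarrow> 'e::{banach,second_countable_topology}) set \<Rightarrow> bool" where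
  "p_choquet_dec M p B \<longleftrightarrow> (\<forall>K\<in>Kdelta M p B. \<forall>Y\<in>Lp M p. kernel_bary M K Y \<longrightarrow> Y \<in> B)"

definition chd :: "'a measure \<Rightarrow> real \<Rightarrow> ('a \<Rightarrow> 'e::{banach,second_countable_topology}) set \<Rightarrow> ('a \<Rightarrow> 'e) set" where
  "chd M p A = \<Inter>{B \<in> Lp_sets M p. A \<subseteq> B \<and> p_choquet_dec M p B}"

definition Lp_borel :: "'a measure \<Rightarrow> real \<Rightarrow> ('a \<Rightarrow> 'e::{banach,second_countable_topology}) measure" where
  "Lp_borel M p = sigma (Lp M p) {U. openin (Lp_top M p) U}"

definition Lp_dual :: "'a measure \<Rightarrow> real \<Rightarrow> (('a \<Rightarrow> 'e::{banach,second_countable_topology}) \<Rightarrow> real) set" where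
  "Lp_dual M p = {l. (\<forall>f\<in>Lp M p. \<forall>g\<in>Lp M p. \<forall>a b::real.
        l (\<lambda>w. a *\<^sub>R f w + b *\<^sub>R g w) = a * l f + b * l g) \<and>
      (\<exists>C. \<forall>f\<in>Lp M p. \<bar>l f\<bar> \<le> C * Lp_norm M p f)}"

definition V_measure :: "'a measure \<Rightarrow> real \<Rightarrow> ('a \<Rightarrow> 'e::{banach,second_countable_topology}) measure \<Rightarrow> bool" where
  "V_measure M p \<mu> \<longleftrightarrow> sets \<mu> = sets (Lp_borel M p) \<and> prob_space \<mu> \<and>
     (\<forall>B\<in>sets \<mu>. emeasure \<mu> B =
        (SUP C\<in>{C \<in> sets \<mu>. C \<subseteq> B \<and> compactin (Lp_top M p) C}. emeasure \<mu> C))"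

definition meas_bary :: "'a measure \<Rightarrow> real \<Rightarrow> ('a \<Rightarrow> 'e::{banach,second_countable_topology}) measure \<Rightarrow> ('a \<Rightarrow> 'e) \<Rightarrow> bool" where
  "meas_bary M p \<mu> y \<longleftrightarrow> y \<in> Lp M p \<and>
     (\<forall>l\<in>Lp_dual M p. integrable \<mu> l \<and> l y = (\<integral>f. l f \<partial>\<mu>))"

definition Mset :: "'a measure \<Rightarrow> real \<Rightarrow> ('a \<Rightarrow> 'e::{banach,second_countable_topology}) set \<Rightarrow> ('a \<Rightarrow> 'e) measure set" where
  "Mset M p B = {\<mu>. \<exists>C. C \<subseteq> B \<and> C \<in> sets (Lp_borel M p) \<and> V_measure M p \<mu> \<and>
      emeasure \<mu> C = 1 \<and> (\<exists>y. meas_bary M p \<mu> y)}"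

definition choquet_set :: "'a measure \<Rightarrow> real \<Rightarrow> ('a \<Rightarrow> 'e::{banach,second_countable_topology}) set \<Rightarrow> bool" where
  "choquet_set M p B \<longleftrightarrow> (\<forall>\<mu>\<in>Mset M p B. \<forall>y. meas_bary M p \<mu> y \<longrightarrow> y \<in> B)"

definition ch :: "'a measure \<Rightarrow> real \<Rightarrow> ('a \<Rightarrow> 'e::{banach,second_countable_topology}) set \<Rightarrow> ('a \<Rightarrow> 'e) set" where
  "ch M p B = \<Inter>{C \<in> Lp_sets M p. B \<subseteq> C \<and> choquet_set M p C}"

end

theory Submission
  imports Defs "HOL-Library.Function_Algebras"
begin

text \<open>
  A Dirac kernel with barycenter \<open>Y\<close> is \<open>\<omega> \<mapsto> \<delta>(Y \<omega>)\<close> a.s., because countably many functionals separate the points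
  of \<open>E\<close>. Hence a nonempty \<open>B\<close> is p-Choquet decomposable iff it contains all integrable selections of
  \<open>F\<^sub>B\<close>, and \<open>chd A = cl dec A\<close> is the least closed decomposable set containing \<open>A\<close>. Convexity passes from
  \<open>A\<close> to \<open>cl dec A\<close> and decomposability from \<open>S\<close> to \<open>cl conv S\<close> (fix one argument, and note that the set of
  admissible other arguments has the closure properties defining the hull), so every hull in the
  chain of equations is the least closed convex decomposable set containing \<open>A\<close>. A closed convex set is a Choquet set
  by Hahn--Banach, and a Choquet set is convex because two-point measures have barycenters.
  The multifunction \<open>F\<^sub>A\<close> and its Castaing representation translate inclusions and convexity between
  decomposable sets and the values of their multifunctions.
\<close>

section \<open>Hahn--Banach\<close>

text \<open>Points are functions, not a.s.-classes, so \<open>Lp M p\<close> is a subspace of the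
  function type with only a seminorm. Pointwise operations make that type a real vector space, in
  which convex hulls are taken, and Hahn--Banach is used in an algebraic form: every real-valued
  convex function on a real vector space has a linear subgradient at every point. It serves twice,
  for the norm of E (functionals separating points) and for the distance to a closed convex subset
  of L^p (separation).

  The recurring obstacle is null sets. A kernel barycenter is one a.s. identity per functional, and
  an inclusion between sets of selections is one a.s. statement per selection. Each time a countable
  family collects them into one null set: separating functionals, essentially dense members of a
  decomposable set, a Castaing representation, rational weights.

  Representatives cost little: closed sets of the seminorm topology contain every representative of
  their members, and so do Borel sets. Finite decompositions vanish outside the probability space,
  so inclusions are stated for \<open>cl dec\<close> rather than for \<open>dec\<close>.\<close>

definition sublinear :: "('v::real_vector \<Rightarrow> real) \<Rightarrow> bool" where
  "sublinear q \<longleftrightarrow> (\<forall>x y. q (x + y) \<le> q x + q y) \<and> (\<forall>t>0. \<forall>x. q (t *\<^sub>R x) \<le> t * q x)"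

lemma sublinear_add: "sublinear q \<Longrightarrow> q (x + y) \<le> q x + q y"
  by (simp add: sublinear_def)

lemma sublinear_zero:
  assumes "sublinear q" shows "q 0 = 0"
proof -
  have "q (0 + 0) \<le> q 0 + q 0" using assms unfolding sublinear_def by blast
  moreover have "q ((1/2) *\<^sub>R 0) \<le> (1/2) * q 0"
    using assms unfolding sublinear_def by (metis half_gt_zero_iff zero_less_one)
  ultimately show ?thesis by simp
qed

text \<open>The reverse inequality is the defining one for \<open>inverse t\<close>. Hence the
  definition can ask for an inequality only, which is the form that infima preserve.\<close>

lemma sublinear_scaleR:
  assumes "sublinear q" "t \<ge> 0"
  shows "q (t *\<^sub>R x) = t * q x"
proof (cases "t = 0")
  case True
  then show ?thesis using assms sublinear_zero by auto
next
  case False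
  then have t: "t > 0" using assms by simp
  have 1: "q (t *\<^sub>R x) \<le> t * q x" using assms t unfolding sublinear_def by blast
  have "q (inverse t *\<^sub>R (t *\<^sub>R x)) \<le> inverse t * q (t *\<^sub>R x)"
    using assms t unfolding sublinear_def by (meson positive_imp_inverse_positive)
  then have "t * q x \<le> q (t *\<^sub>R x)" using t by (simp add: field_simps)
  with 1 show ?thesis by simp
qed

lemma sublinear_ge_minus: "sublinear q \<Longrightarrow> - q (- x) \<le> q x"
  using sublinear_add[of q x "-x"] sublinear_zero[of q] by simp

text \<open>The single \<open>f i\<close> need not be sublinear; it suffices that each inequality
  holds after passing to another index. This covers infima of chains as well as infima of difference
  quotients.\<close>

lemma sublinear_INF:
  fixes f :: "'i \<Rightarrow> 'v::real_vector \<Rightarrow> real"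
  assumes ne: "I \<noteq> {}" and bdd: "\<And>x. bdd_below ((\<lambda>i. f i x) ` I)"
    and add: "\<And>i j x y. i \<in> I \<Longrightarrow> j \<in> I \<Longrightarrow> \<exists>k\<in>I. f k (x + y) \<le> f i x + f j y"
    and scale: "\<And>i t x. i \<in> I \<Longrightarrow> t > 0 \<Longrightarrow> \<exists>k\<in>I. f k (t *\<^sub>R x) \<le> t * f i x"
  shows "sublinear (\<lambda>x. INF i\<in>I. f i x)" (is "sublinear ?u")
  unfolding sublinear_def
proof (intro conjI allI impI)
  fix x y :: 'v
  have "?u (x + y) - ?u y \<le> f i x" if i: "i \<in> I" for i
  proof -
    have "?u (x + y) - f i x \<le> f j y" if j: "j \<in> I" for j
    proof -
      obtain k where "k \<in> I" "f k (x + y) \<le> f i x + f j y" using add[OF i j] by blast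
      moreover have "?u (x + y) \<le> f k (x + y)" by (rule cINF_lower[OF bdd \<open>k \<in> I\<close>])
      ultimately show ?thesis by simp
    qed
    then have "?u (x + y) - f i x \<le> ?u y" by (rule cINF_greatest[OF ne])
    then show ?thesis by simp
  qed
  then have "?u (x + y) - ?u y \<le> ?u x" by (rule cINF_greatest[OF ne])
  then show "?u (x + y) \<le> ?u x + ?u y" by simp
next
  fix t :: real and x :: 'v
  assume t: "t > 0"
  have "?u (t *\<^sub>R x) / t \<le> f i x" if i: "i \<in> I" for i
  proof -
    obtain k where "k \<in> I" "f k (t *\<^sub>R x) \<le> t * f i x" using scale[OF i t] by blast
    moreover have "?u (t *\<^sub>R x) \<le> f k (t *\<^sub>R x)" by (rule cINF_lower[OF bdd \<open>k \<in> I\<close>])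
    ultimately show ?thesis using t by (simp add: field_simps)
  qed
  then have "?u (t *\<^sub>R x) / t \<le> ?u x" by (rule cINF_greatest[OF ne])
  then show "?u (t *\<^sub>R x) \<le> t * ?u x" using t by (simp add: field_simps)
qed

lemma sublinear_minimal_exists:
  fixes p :: "'v::real_vector \<Rightarrow> real"
  assumes p: "sublinear p"
  obtains q where "sublinear q" "q \<le> p" "\<And>r. sublinear r \<Longrightarrow> r \<le> q \<Longrightarrow> r = q"
proof -
  define A where "A = {q. sublinear q \<and> q \<le> p}"
  \<comment> \<open>Zorn's lemma is applied to the reversed pointwise order, so its maximal elements
    are the minimal sublinear functionals below \<open>p\<close>.\<close>
  have "\<exists>m\<in>A. \<forall>a\<in>A. a \<le> m \<longrightarrow> a = m"
  proof (rule predicate_Zorn[where P = "\<lambda>a b. b \<le> a"])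
    show "partial_order_on A (relation_of (\<lambda>a b. b \<le> a) A)"
      unfolding partial_order_on_def preorder_on_def relation_of_def refl_on_def trans_on_def antisym_on_def
      by auto
    fix C assume C: "C \<in> Chains (relation_of (\<lambda>a b. b \<le> a) A)"
    show "\<exists>u\<in>A. \<forall>a\<in>C. u \<le> a"
    proof (cases "C = {}")
      case True
      then show ?thesis using p by (auto simp: A_def)
    next
      case False
      have sub: "C \<subseteq> A" and chain: "\<And>a b. a \<in> C \<Longrightarrow> b \<in> C \<Longrightarrow> a \<le> b \<or> b \<le> a"
        using C by (auto simp: Chains_def relation_of_def)
      have subl: "sublinear q" if "q \<in> C" for q
        using that sub by (auto simp: A_def)
      \<comment> \<open>The bound does not depend on \<open>q\<close>, so the pointwise infimum over
        the chain is finite.\<close>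
      have low: "- p (- x) \<le> q x" if "q \<in> C" for q x
      proof -
        have "sublinear q" "q (- x) \<le> p (- x)" using that sub by (auto simp: A_def le_fun_def)
        then show ?thesis using sublinear_ge_minus[of q x] by linarith
      qed
      have bdd: "bdd_below ((\<lambda>q. q x) ` C)" for x
        using low by (intro bdd_belowI2[where m="- p (- x)"])
      define u where "u = (\<lambda>x. INF q\<in>C. q x)"
      have "sublinear u"
        unfolding u_def
      proof (rule sublinear_INF[OF False bdd])
        fix q r and x y :: 'v assume q: "q \<in> C" and r: "r \<in> C"
        from chain[OF q r] show "\<exists>k\<in>C. k (x + y) \<le> q x + r y"
        proof
          assume "q \<le> r"
          then have "q (x + y) \<le> q x + r y"
            using sublinear_add[OF subl[OF q], of x y] by (metis add_left_mono le_funD order_trans)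
          then show ?thesis using q by blast
        next
          assume "r \<le> q"
          then have "r (x + y) \<le> q x + r y"
            using sublinear_add[OF subl[OF r], of x y] by (metis add_right_mono le_funD order_trans)
          then show ?thesis using r by blast
        qed
      next
        fix q and t :: real and x :: 'v assume q: "q \<in> C" and "t > 0"
        then show "\<exists>k\<in>C. k (t *\<^sub>R x) \<le> t * q x"
          using sub by (intro bexI[of _ q]) (auto simp: A_def sublinear_def)
      qed
      moreover have le: "u \<le> q" if "q \<in> C" for q
        unfolding u_def le_fun_def using cINF_lower[OF bdd that] by auto
      moreover have "u \<le> p"
      proof -
        obtain q where "q \<in> C" using False by blast
        then have "u \<le> q" "q \<le> p" using le[of q] sub unfolding A_def by blast+
        then show ?thesis by (rule order_trans)
      qed
      ultimately show ?thesis by (auto simp: A_def)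
    qed
  qed
  then obtain m where "m \<in> A" and m: "\<forall>a\<in>A. a \<le> m \<longrightarrow> a = m" by blast
  show ?thesis
  proof (rule that[of m])
    show "sublinear m" "m \<le> p" using \<open>m \<in> A\<close> by (auto simp: A_def)
    fix r assume "sublinear r" "r \<le> m"
    then have "r \<in> A" using \<open>m \<le> p\<close> order_trans[of r m p] by (simp add: A_def)
    then show "r = m" using m \<open>r \<le> m\<close> by blast
  qed
qed

text \<open>Minimality takes the place of the one-dimensional extension step of Hahn--Banach: a
  functional that cannot be lowered along any direction is additive, hence odd, hence homogeneous
  for negative scalars too.\<close>

lemma sublinear_minimal_linear:
  fixes q :: "'v::real_vector \<Rightarrow> real"
  assumes q: "sublinear q" and min: "\<And>r. sublinear r \<Longrightarrow> r \<le> q \<Longrightarrow> r = q"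
  shows "linear q"
proof -
  have add: "q (x + y) = q x + q y" for x y
  proof -
    \<comment> \<open>\<open>r\<close> is a sublinear minorant of \<open>q\<close>; its term \<open>t = 1\<close> gives superadditivity once \<open>r = q\<close>.\<close>
    define r where "r = (\<lambda>z. INF t\<in>{0::real..}. q (z + t *\<^sub>R y) - t * q y)"
    have low: "- q (- z) \<le> q (z + t *\<^sub>R y) - t * q y" if "t \<in> {0..}" for t z
      using sublinear_add[OF q, of "z + t *\<^sub>R y" "- z"] sublinear_scaleR[OF q, of t y] that by simp
    have bdd: "bdd_below ((\<lambda>t. q (z + t *\<^sub>R y) - t * q y) ` {0..})" for z
      using low by (intro bdd_belowI2[where m="- q (- z)"])
    have "sublinear r"
      unfolding r_def
    proof (rule sublinear_INF[OF _ bdd])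
      fix s t :: real and z w :: 'v assume st: "s \<in> {0..}" "t \<in> {0..}"
      show "\<exists>k\<in>{0..}. q (z + w + k *\<^sub>R y) - k * q y \<le> (q (z + s *\<^sub>R y) - s * q y) + (q (w + t *\<^sub>R y) - t * q y)"
        using st sublinear_add[OF q, of "z + s *\<^sub>R y" "w + t *\<^sub>R y"]
        by (intro bexI[of _ "s + t"]) (auto simp: algebra_simps)
    next
      fix s t :: real and z :: 'v assume st: "s \<in> {0..}" "t > 0"
      show "\<exists>k\<in>{0..}. q (t *\<^sub>R z + k *\<^sub>R y) - k * q y \<le> t * (q (z + s *\<^sub>R y) - s * q y)"
        using st sublinear_scaleR[OF q, of t "z + s *\<^sub>R y"]
        by (intro bexI[of _ "t * s"]) (auto simp: algebra_simps)
    qed auto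
    moreover have "r \<le> q"
    proof (rule le_funI)
      fix z
      have "r z \<le> q (z + 0 *\<^sub>R y) - 0 * q y" unfolding r_def by (rule cINF_lower[OF bdd]) auto
      then show "r z \<le> q z" by simp
    qed
    ultimately have "r = q" by (rule min)
    have "r x \<le> q (x + 1 *\<^sub>R y) - 1 * q y" unfolding r_def by (rule cINF_lower[OF bdd]) auto
    then show ?thesis using \<open>r = q\<close> sublinear_add[OF q, of x y] by simp
  qed
  have neg: "q (- x) = - q x" for x
    using add[of x "- x"] sublinear_zero[OF q] by simp
  show ?thesis
  proof (rule linearI[OF add])
    fix t x
    show "q (t *\<^sub>R x) = t *\<^sub>R q x"
      using sublinear_scaleR[OF q, of t x] sublinear_scaleR[OF q, of "-t" x] neg[of "t *\<^sub>R x"]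
      by (cases "t \<ge> 0") auto
  qed
qed

text \<open>The infimum of the difference quotients at \<open>y\<close> is the one-sided directional
  derivative, which is sublinear in the direction. A minimal sublinear functional below it is
  linear, and the quotient at \<open>t = 1\<close> gives the claimed bound.\<close>

lemma convex_subgradient:
  fixes \<phi> :: "'v::real_vector \<Rightarrow> real"
  assumes cvx: "convex_on UNIV \<phi>"
  obtains l where "linear l" "\<And>h. l h \<le> \<phi> (y + h) - \<phi> y"
proof -
  have cvxD: "\<phi> (u *\<^sub>R a + v *\<^sub>R b) \<le> u * \<phi> a + v * \<phi> b"
    if "u \<ge> 0" "v \<ge> 0" "u + v = 1" for u v a b
    using cvx that unfolding convex_on_def by blast
  define d where "d = (\<lambda>t h. (\<phi> (y + t *\<^sub>R h) - \<phi> y) / t)"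
  \<comment> \<open>The point \<open>y\<close> lies between \<open>y - h\<close> and
    \<open>y + t h\<close> with weights \<open>t / (1 + t)\<close> and \<open>1 / (1 + t)\<close>;
    convexity there bounds all quotients from below.\<close>
  have low: "\<phi> y - \<phi> (y - h) \<le> d t h" if t: "t \<in> {0<..}" for t h
  proof -
    have e: "t / (1 + t) + 1 / (1 + t) = 1" using t by (simp add: field_simps)
    have "(t / (1 + t)) *\<^sub>R (y - h) + (1 / (1 + t)) *\<^sub>R (y + t *\<^sub>R h)
        = (t / (1 + t) + 1 / (1 + t)) *\<^sub>R y"
      by (simp add: algebra_simps)
    also have "\<dots> = y" by (simp only: e scaleR_one)
    finally have y: "(t / (1 + t)) *\<^sub>R (y - h) + (1 / (1 + t)) *\<^sub>R (y + t *\<^sub>R h) = y" .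
    have "\<phi> y \<le> (t / (1 + t)) * \<phi> (y - h) + (1 / (1 + t)) * \<phi> (y + t *\<^sub>R h)"
      using cvxD[of "t / (1 + t)" "1 / (1 + t)" "y - h" "y + t *\<^sub>R h"] e t by (simp add: y)
    also have "\<dots> = (t * \<phi> (y - h) + \<phi> (y + t *\<^sub>R h)) / (1 + t)"
      by (simp add: add_divide_distrib)
    finally have "(1 + t) * \<phi> y \<le> t * \<phi> (y - h) + \<phi> (y + t *\<^sub>R h)"
      using t by (simp add: pos_le_divide_eq mult.commute)
    then show ?thesis using t by (simp add: d_def field_simps)
  qed
  have bdd: "bdd_below ((\<lambda>t. d t h) ` {0<..})" for h
    using low by (intro bdd_belowI2[where m="\<phi> y - \<phi> (y - h)"])
  have "sublinear (\<lambda>h. INF t\<in>{0<..}. d t h)"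
  proof (rule sublinear_INF[OF _ bdd])
    fix s t :: real and g h :: 'v assume st: "s \<in> {0<..}" "t \<in> {0<..}"
    \<comment> \<open>Chosen by \<open>1/k = 1/s + 1/t\<close>: the average of
      \<open>y + s g\<close> and \<open>y + t h\<close> with weights \<open>t / (s + t)\<close> and
      \<open>s / (s + t)\<close> is then \<open>y + k (g + h)\<close>, and dividing by
      \<open>k\<close> splits into the two given quotients.\<close>
    define k where "k = s * t / (s + t)"
    have k: "k > 0" using st by (simp add: k_def)
    have e: "t / (s + t) + s / (s + t) = 1"
      using st by (simp add: add_divide_distrib[symmetric] add.commute)
    have "(t / (s + t)) *\<^sub>R (y + s *\<^sub>R g) + (s / (s + t)) *\<^sub>R (y + t *\<^sub>R h)
      = (t / (s + t) + s / (s + t)) *\<^sub>R y + k *\<^sub>R (g + h)"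
      by (simp add: algebra_simps k_def)
    also have "\<dots> = y + k *\<^sub>R (g + h)" by (simp only: e scaleR_one)
    finally have k_eq: "(t / (s + t)) *\<^sub>R (y + s *\<^sub>R g) + (s / (s + t)) *\<^sub>R (y + t *\<^sub>R h) = y + k *\<^sub>R (g + h)" .
    have "\<phi> (y + k *\<^sub>R (g + h)) \<le> (t / (s + t)) * \<phi> (y + s *\<^sub>R g) + (s / (s + t)) * \<phi> (y + t *\<^sub>R h)"
      using cvxD[of "t / (s + t)" "s / (s + t)" "y + s *\<^sub>R g" "y + t *\<^sub>R h"] e st by (simp add: k_eq)
    also have "\<dots> = (t * \<phi> (y + s *\<^sub>R g) + s * \<phi> (y + t *\<^sub>R h)) / (s + t)"
      by (simp add: add_divide_distrib)
    finally have "(s + t) * \<phi> (y + k *\<^sub>R (g + h)) \<le> t * \<phi> (y + s *\<^sub>R g) + s * \<phi> (y + t *\<^sub>R h)"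
      using st by (simp add: pos_le_divide_eq mult.commute)
    then have "((s + t) * \<phi> (y + k *\<^sub>R (g + h)) - (s + t) * \<phi> y) / (s * t)
        \<le> (t * \<phi> (y + s *\<^sub>R g) + s * \<phi> (y + t *\<^sub>R h) - (s + t) * \<phi> y) / (s * t)"
      using st by (intro divide_right_mono) auto
    moreover have "d k (g + h) = ((s + t) * \<phi> (y + k *\<^sub>R (g + h)) - (s + t) * \<phi> y) / (s * t)"
      using st unfolding d_def by (simp add: k_def right_diff_distrib mult.commute)
    moreover have "d s g + d t h = (t * \<phi> (y + s *\<^sub>R g) + s * \<phi> (y + t *\<^sub>R h) - (s + t) * \<phi> y) / (s * t)"
      using st unfolding d_def by (simp add: field_simps)
    ultimately have "d k (g + h) \<le> d s g + d t h" by simp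
    then show "\<exists>k\<in>{0<..}. d k (g + h) \<le> d s g + d t h" using k by auto
  next
    fix s t :: real and h :: 'v assume st: "s \<in> {0<..}" "t > 0"
    then show "\<exists>k\<in>{0<..}. d k (t *\<^sub>R h) \<le> t * d s h"
      by (intro bexI[of _ "s / t"]) (auto simp: d_def field_simps)
  qed auto
  then obtain q where q: "sublinear q" "q \<le> (\<lambda>h. INF t\<in>{0<..}. d t h)"
      "\<And>r. sublinear r \<Longrightarrow> r \<le> q \<Longrightarrow> r = q"
    by (rule sublinear_minimal_exists) blast
  show ?thesis
  proof (rule that[of q])
    show "linear q" using q by (intro sublinear_minimal_linear)
    fix h
    have "q h \<le> (INF t\<in>{0<..}. d t h)" using q(2) by (simp add: le_fun_def)
    also have "\<dots> \<le> d 1 h" by (rule cINF_lower[OF bdd]) auto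
    finally show "q h \<le> \<phi> (y + h) - \<phi> y" by (simp add: d_def)
  qed
qed

text \<open>A subgradient of the norm at \<open>x\<close> is dominated by the norm, and the
  direction \<open>- x\<close> forces its value at \<open>x\<close> up to
  \<open>norm x\<close>.\<close>

lemma norming_functional:
  fixes x :: "'e::real_normed_vector"
  obtains L :: "'e \<Rightarrow> real" where "bounded_linear L" "\<And>h. \<bar>L h\<bar> \<le> norm h" "L x = norm x"
proof -
  have "convex_on UNIV (norm :: 'e \<Rightarrow> real)"
    by (intro convex_onI) (auto intro!: order_trans[OF norm_triangle_ineq])
  then obtain L where L: "linear L" "\<And>h. L h \<le> norm (x + h) - norm x"
    by (rule convex_subgradient[where y=x]) blast
  have le: "L h \<le> norm h" for h
    using L(2)[of h] norm_triangle_ineq[of x h] by linarith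
  have abs: "\<bar>L h\<bar> \<le> norm h" for h
    using le[of h] le[of "- h"] linear_neg[OF L(1), of h] by simp
  have "L (- x) \<le> - norm x" using L(2)[of "- x"] by simp
  then have "L x = norm x" using le[of x] linear_neg[OF L(1), of x] by simp
  moreover have "bounded_linear L"
    using L(1) abs by (intro bounded_linear_intro[where K=1]) (auto simp: linear_add linear_scale)
  ultimately show ?thesis using abs that by blast
qed

lemma separable_dense_sequence:
  obtains d :: "nat \<Rightarrow> 'e::{metric_space,second_countable_topology}"
  where "\<And>y e. e > 0 \<Longrightarrow> \<exists>n. dist (d n) y < e"
proof -
  obtain D :: "'e set" where D: "countable D" "\<And>X. open X \<Longrightarrow> X \<noteq> {} \<Longrightarrow> \<exists>d\<in>D. d \<in> X"
    using countable_dense_exists by metis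
  have "D \<noteq> {}" using D(2)[of UNIV] by auto
  show ?thesis
  proof (rule that[of "from_nat_into D"])
    fix y :: 'e and e :: real assume "e > 0"
    then obtain z where "z \<in> D" "z \<in> ball y e" using D(2)[of "ball y e"] by force
    then show "\<exists>n. dist (from_nat_into D n) y < e"
      using from_nat_into_surj[OF D(1)] by (metis dist_commute mem_ball)
  qed
qed

lemma separating_functionals:
  obtains L :: "nat \<Rightarrow> 'e::{real_normed_vector,second_countable_topology} \<Rightarrow> real"
  where "\<And>n. bounded_linear (L n)" "\<And>x. (\<And>n. L n x = 0) \<Longrightarrow> x = 0"
proof -
  obtain d :: "nat \<Rightarrow> 'e" where d: "\<And>y e. e > 0 \<Longrightarrow> \<exists>n. dist (d n) y < e"
    using separable_dense_sequence by blast
  have "\<exists>L. bounded_linear L \<and> (\<forall>h. \<bar>L h\<bar> \<le> norm h) \<and> L (d n) = norm (d n)" for n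
    using norming_functional[of "d n"] by metis
  then obtain L where L: "\<And>n. bounded_linear (L n)" "\<And>n h. \<bar>L n h\<bar> \<le> norm h"
      "\<And>n. L n (d n) = norm (d n)"
    by metis
  show ?thesis
  proof (rule that[of L, OF L(1)])
    fix x assume z: "\<And>n. L n x = 0"
    show "x = 0"
    proof (rule ccontr)
      assume "x \<noteq> 0"
      \<comment> \<open>Half the norm is enough: \<open>d n\<close> turns out to have norm below
        \<open>norm x / 2\<close> while being closer than \<open>norm x / 2\<close> to
        \<open>x\<close>, against the triangle inequality.\<close>
      then obtain n where n: "dist (d n) x < norm x / 2" using d[of "norm x / 2" x] by auto
      have "norm (d n) = L n (d n - x)" using L(3)[of n] z[of n] linear_diff[OF bounded_linear.linear[OF L(1)]] by simp
      also have "\<dots> \<le> norm (d n - x)" using L(2)[of n "d n - x"] by simp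
      finally have "norm (d n) < norm x / 2" using n by (simp add: dist_norm)
      then show False using n norm_triangle_ineq2[of x "d n"] by (simp add: dist_norm norm_minus_commute)
    qed
  qed
qed

section \<open>Pointwise operations on functions\<close>

text \<open>With this the notions \<open>convex\<close>, \<open>hull\<close>,
  \<open>subspace\<close> and \<open>linear\<close> apply to sets of functions. The seminorm stays a
  separate function, since it is meaningful only on \<open>Lp M p\<close>.\<close>

instantiation "fun" :: (type, scaleR) scaleR
begin
definition "c *\<^sub>R f = (\<lambda>x. c *\<^sub>R f x)"
instance ..
end

lemma scaleR_fun_apply [simp]: "(c *\<^sub>R f) x = c *\<^sub>R f x"
  by (simp add: scaleR_fun_def)

instance "fun" :: (type, real_vector) real_vector
  by standard (simp_all add: fun_eq_iff scaleR_add_right scaleR_add_left)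

lemma sum_fun_apply: "sum f I x = (\<Sum>i\<in>I. f i x)"
  by (induction I rule: infinite_finite_induct) auto

lemma Lp_convex_iff_convex: "Lp_convex C \<longleftrightarrow> convex C"
proof -
  have *: "(\<lambda>w. t *\<^sub>R f w + (1 - t) *\<^sub>R g w) = t *\<^sub>R f + (1 - t) *\<^sub>R g" for t and f g :: "'a \<Rightarrow> 'b"
    by (auto simp: fun_eq_iff)
  show ?thesis
    unfolding Lp_convex_def * convex_alt
    by (subst (2) add.commute) blast
qed

lemma Lp_conv_eq_convex_hull: "Lp_conv A = convex hull A"
proof -
  have *: "(\<lambda>w. \<Sum>i\<in>I. c i *\<^sub>R f i w) = (\<Sum>i\<in>I. c i *\<^sub>R f i)" for c and f :: "nat \<Rightarrow> 'a \<Rightarrow> 'b" and I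
    by (auto simp: fun_eq_iff sum_fun_apply)
  show ?thesis
  proof (intro equalityI subsetI)
    fix g assume "g \<in> Lp_conv A"
    then obtain I :: "nat set" and c f where "finite I" "I \<noteq> {}" "\<forall>i\<in>I. 0 \<le> c i \<and> f i \<in> A" "sum c I = 1"
        and g: "g = (\<Sum>i\<in>I. c i *\<^sub>R f i)"
      unfolding Lp_conv_def * by blast
    then show "g \<in> convex hull A"
      unfolding g by (intro convex_sum[OF _ convex_convex_hull]) (auto intro: hull_inc)
  next
    fix g assume "g \<in> convex hull A"
    then obtain k u x where "\<forall>i\<in>{1::nat..k}. 0 \<le> u i \<and> x i \<in> A" "sum u {1..k} = 1"
        "(\<Sum>i = 1..k. u i *\<^sub>R x i) = g"
      unfolding convex_hull_indexed by blast
    moreover from this(2) have "{1..k} \<noteq> {}" by (metis sum.empty zero_neq_one)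
    ultimately show "g \<in> Lp_conv A"
      unfolding Lp_conv_def * by (intro CollectI exI[of _ "{1..k}"] exI[of _ u] exI[of _ x]) auto
  qed
qed

section \<open>The seminormed space of p-integrable functions\<close>

text \<open>The endpoint 0 is treated apart: there the claim reduces to
  \<open>(u * z) powr p \<le> u * z powr p\<close>, which holds since
  \<open>u powr p \<le> u\<close> for \<open>0 < u < 1\<close>.\<close>

lemma convex_on_powr:
  fixes p :: real
  assumes "1 \<le> p"
  shows "convex_on {0..} (\<lambda>x. x powr p)"
proof (rule convex_onI)
  fix t x y :: real
  assume t: "0 < t" "t < 1" and xy: "x \<in> {0..}" "y \<in> {0..}"
  have small: "(u * z) powr p \<le> u * z powr p" if "0 < u" "u < 1" "0 \<le> z" for u z :: real
  proof -
    have "u powr p \<le> u powr 1" using that assms by (intro powr_mono') auto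
    then show ?thesis using that by (simp add: powr_mult mult_right_mono)
  qed
  show "((1 - t) *\<^sub>R x + t *\<^sub>R y) powr p \<le> (1 - t) * x powr p + t * y powr p"
  proof (cases "x = 0 \<or> y = 0")
    case True
    then show ?thesis
      using small[of t y] small[of "1 - t" x] t xy assms by auto
  next
    case False
    then show ?thesis
      using convex_onD[OF powr_convex[OF assms], of t x y] t xy by auto
  qed
qed simp

text \<open>A crude bound through \<open>x + y \<le> 2 * max x y\<close>; it gives integrability of
  sums ahead of Minkowski's inequality.\<close>

lemma powr_add_le:
  fixes p x y :: real
  assumes "1 \<le> p" "0 \<le> x" "0 \<le> y"
  shows "(x + y) powr p \<le> 2 powr p * (x powr p + y powr p)"
proof -
  have "(x + y) powr p \<le> (2 * max x y) powr p" using assms by (intro powr_mono2) auto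
  also have "\<dots> = 2 powr p * max x y powr p" using assms by (simp add: powr_mult)
  also have "\<dots> \<le> 2 powr p * (x powr p + y powr p)"
    using assms by (intro mult_left_mono) (auto simp: max_def)
  finally show ?thesis .
qed

locale Lp_space = prob_space M for M :: "'a measure" +
  fixes p :: real
  assumes p_ge_1: "1 \<le> p"
begin

lemma Lp_measurable [measurable_dest]: "f \<in> Lp M p \<Longrightarrow> f \<in> borel_measurable M"
  by (simp add: Lp_def)

lemma Lp_integrable: "f \<in> Lp M p \<Longrightarrow> integrable M (\<lambda>w. norm (f w) powr p)"
  by (simp add: Lp_def)

lemma Lp_bound:
  assumes "f \<in> borel_measurable M" "integrable M h" "AE w in M. norm (f w) powr p \<le> h w"
  shows "f \<in> Lp M p"
  using assms unfolding Lp_def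
  by (auto intro!: Bochner_Integration.integrable_bound[OF assms(2)])

lemma Lp_add:
  fixes f g :: "'a \<Rightarrow> 'e::{banach,second_countable_topology}"
  assumes "f \<in> Lp M p" "g \<in> Lp M p" shows "f + g \<in> Lp M p"
proof (rule Lp_bound)
  show "integrable M (\<lambda>w. 2 powr p * (norm (f w) powr p + norm (g w) powr p))"
    using assms by (intro integrable_mult_right Bochner_Integration.integrable_add Lp_integrable)
  show "f + g \<in> borel_measurable M"
    using assms Lp_measurable unfolding plus_fun_def by (auto intro: borel_measurable_add)
  have "norm (f w + g w) powr p \<le> 2 powr p * (norm (f w) powr p + norm (g w) powr p)" for w
    using p_ge_1
    by (intro order_trans[OF powr_mono2[OF _ _ norm_triangle_ineq] powr_add_le]) auto
  then show "AE w in M. norm ((f + g) w) powr p \<le> 2 powr p * (norm (f w) powr p + norm (g w) powr p)"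
    by simp
qed

lemma Lp_scaleR:
  fixes f :: "'a \<Rightarrow> 'e::{banach,second_countable_topology}"
  assumes "f \<in> Lp M p" shows "c *\<^sub>R f \<in> Lp M p"
  using assms unfolding Lp_def scaleR_fun_def by (auto simp: powr_mult)

lemma Lp_zero: "0 \<in> Lp M p"
  using p_ge_1 unfolding Lp_def zero_fun_def by auto

lemma subspace_Lp: "subspace (Lp M p :: ('a \<Rightarrow> 'e::{banach,second_countable_topology}) set)"
  by (simp add: subspace_def Lp_zero Lp_add Lp_scaleR)

lemma Lp_diff: "f \<in> Lp M p \<Longrightarrow> g \<in> Lp M p \<Longrightarrow> f - g \<in> Lp M p"
  by (rule subspace_diff[OF subspace_Lp])

lemma Lp_convex_comb:
  "f \<in> Lp M p \<Longrightarrow> g \<in> Lp M p \<Longrightarrow> a *\<^sub>R f + b *\<^sub>R g \<in> Lp M p"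
  by (simp add: Lp_add Lp_scaleR)

lemma Lp_if:
  fixes f g :: "'a \<Rightarrow> 'e::{banach,second_countable_topology}"
  assumes f: "f \<in> Lp M p" and g: "g \<in> Lp M p" and B: "B \<in> sets M"
  shows "(\<lambda>w. if w \<in> B then f w else g w) \<in> Lp M p"
proof (rule Lp_bound)
  show "integrable M (\<lambda>w. norm (f w) powr p + norm (g w) powr p)"
    using f g by (intro Bochner_Integration.integrable_add Lp_integrable)
  show "(\<lambda>w. if w \<in> B then f w else g w) \<in> borel_measurable M"
    using f g B Lp_measurable by (intro measurable_If_set) auto
qed auto

subsection \<open>Minkowski's inequality\<close>

lemma Lp_norm_nonneg [simp]: "0 \<le> Lp_norm M p f"
  by (simp add: Lp_norm_def)

lemma Lp_norm_powr: "Lp_norm M p f powr p = (\<integral>w. norm (f w) powr p \<partial>M)"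
  using p_ge_1 by (simp add: Lp_norm_def powr_powr)

lemma Lp_norm_less_iff:
  assumes "0 < e"
  shows "Lp_norm M p f < e \<longleftrightarrow> (\<integral>w. norm (f w) powr p \<partial>M) < e powr p"
  unfolding Lp_norm_powr[symmetric]
  using p_ge_1 assms powr_less_mono2[of p "Lp_norm M p f" e] powr_mono2[of p e "Lp_norm M p f"] Lp_norm_nonneg[of f]
  by (smt (verit))

lemma Lp_norm_cong_AE:
  fixes f g :: "'a \<Rightarrow> 'e::{banach,second_countable_topology}"
  assumes "f \<in> borel_measurable M" "g \<in> borel_measurable M" "AE w in M. norm (f w) = norm (g w)"
  shows "Lp_norm M p f = Lp_norm M p g"
proof -
  have "(\<integral>w. norm (f w) powr p \<partial>M) = (\<integral>w. norm (g w) powr p \<partial>M)"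
    using assms by (intro integral_cong_AE) auto
  then show ?thesis by (simp add: Lp_norm_def)
qed

lemma Lp_norm_mono:
  fixes f :: "'a \<Rightarrow> 'e::{banach,second_countable_topology}" and g :: "'a \<Rightarrow> 'f::{banach,second_countable_topology}"
  assumes "f \<in> Lp M p" "g \<in> Lp M p" "AE w in M. norm (f w) \<le> norm (g w)"
  shows "Lp_norm M p f \<le> Lp_norm M p g"
  unfolding Lp_norm_def
proof (rule powr_mono2)
  show "(\<integral>w. norm (f w) powr p \<partial>M) \<le> (\<integral>w. norm (g w) powr p \<partial>M)"
    using assms p_ge_1
    by (intro integral_mono_AE Lp_integrable) (auto intro: powr_mono2 elim!: eventually_mono)
qed (use p_ge_1 in auto)

lemma Lp_norm_zero [simp]: "Lp_norm M p 0 = 0"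
  by (simp add: Lp_norm_def)

lemma Lp_norm_scaleR:
  fixes f :: "'a \<Rightarrow> 'e::{banach,second_countable_topology}"
  shows "Lp_norm M p (c *\<^sub>R f) = \<bar>c\<bar> * Lp_norm M p f"
  using p_ge_1 by (simp add: Lp_norm_def powr_mult powr_powr)

lemma Lp_norm_minus_commute:
  fixes f g :: "'a \<Rightarrow> 'e::{banach,second_countable_topology}"
  shows "Lp_norm M p (f - g) = Lp_norm M p (g - f)"
  by (simp add: Lp_norm_def norm_minus_commute)

text \<open>Minkowski in strict form. The quotient \<open>(norm f + norm g) / (a + b)\<close> is the
  average of \<open>norm f / a\<close> and \<open>norm g / b\<close> with weights
  \<open>a / (a + b)\<close> and \<open>b / (a + b)\<close>; convexity of the p-th power is then
  integrated. Strict upper bounds \<open>a\<close>, \<open>b\<close> avoid dividing by a vanishing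
  norm.\<close>

lemma Lp_norm_add_less:
  fixes f g :: "'a \<Rightarrow> 'e::{banach,second_countable_topology}"
  assumes f: "f \<in> Lp M p" and g: "g \<in> Lp M p"
    and a: "Lp_norm M p f < a" and b: "Lp_norm M p g < b"
  shows "Lp_norm M p (f + g) < a + b"
proof -
  have pos: "0 < a" "0 < b" using a b Lp_norm_nonneg[of f] Lp_norm_nonneg[of g] by linarith+
  have e: "a / (a + b) + b / (a + b) = 1" using pos by (simp add: add_divide_distrib[symmetric])
  have pt: "(norm (f w + g w) / (a + b)) powr p
     \<le> a / (a + b) * (norm (f w) powr p / a powr p) + b / (a + b) * (norm (g w) powr p / b powr p)" for w
  proof -
    have "(norm (f w + g w) / (a + b)) powr p \<le> ((norm (f w) + norm (g w)) / (a + b)) powr p"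
      using pos p_ge_1 by (intro powr_mono2 divide_right_mono norm_triangle_ineq) auto
    also have "(norm (f w) + norm (g w)) / (a + b)
        = (1 - b / (a + b)) *\<^sub>R (norm (f w) / a) + (b / (a + b)) *\<^sub>R (norm (g w) / b)"
    proof -
      have "1 - b / (a + b) = a / (a + b)" using e by simp
      then show ?thesis using pos by (simp add: add_divide_distrib)
    qed
    also have "\<dots> powr p \<le> (1 - b / (a + b)) * (norm (f w) / a) powr p + (b / (a + b)) * (norm (g w) / b) powr p"
      using pos by (intro convex_onD[OF convex_on_powr[OF p_ge_1]]) auto
    also have "1 - b / (a + b) = a / (a + b)" using e by simp
    finally show ?thesis using pos by (simp add: powr_divide)
  qed
  have "(\<integral>w. norm (f w + g w) powr p \<partial>M) / (a + b) powr p = (\<integral>w. (norm (f w + g w) / (a + b)) powr p \<partial>M)"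
    using pos by (simp add: powr_divide)
  also have "\<dots> \<le> (\<integral>w. a / (a + b) * (norm (f w) powr p / a powr p) + b / (a + b) * (norm (g w) powr p / b powr p) \<partial>M)"
    using Lp_integrable[OF Lp_add[OF f g]] Lp_integrable[OF f] Lp_integrable[OF g] pos pt
    by (intro integral_mono) (auto simp: powr_divide)
  also have "\<dots> = a / (a + b) * ((\<integral>w. norm (f w) powr p \<partial>M) / a powr p)
      + b / (a + b) * ((\<integral>w. norm (g w) powr p \<partial>M) / b powr p)"
    using Lp_integrable[OF f] Lp_integrable[OF g] by simp
  also have "\<dots> < a / (a + b) * 1 + b / (a + b) * 1"
    using a b pos Lp_norm_less_iff[of a f] Lp_norm_less_iff[of b g]
    by (intro add_strict_mono mult_strict_left_mono) auto
  also have "\<dots> = 1" using e by simp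
  finally have "(\<integral>w. norm (f w + g w) powr p \<partial>M) < (a + b) powr p"
    using pos by (simp add: pos_divide_less_eq)
  then show ?thesis using pos by (simp add: Lp_norm_less_iff)
qed

lemma Lp_norm_triangle:
  fixes f g :: "'a \<Rightarrow> 'e::{banach,second_countable_topology}"
  assumes "f \<in> Lp M p" "g \<in> Lp M p"
  shows "Lp_norm M p (f + g) \<le> Lp_norm M p f + Lp_norm M p g"
proof (rule field_le_epsilon)
  fix e :: real assume "e > 0"
  then show "Lp_norm M p (f + g) \<le> Lp_norm M p f + Lp_norm M p g + e"
    using Lp_norm_add_less[OF assms, of "Lp_norm M p f + e / 2" "Lp_norm M p g + e / 2"] by simp
qed

lemma Lp_norm_diff_triangle:
  fixes f g h :: "'a \<Rightarrow> 'e::{banach,second_countable_topology}"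
  assumes "f \<in> Lp M p" "g \<in> Lp M p" "h \<in> Lp M p"
  shows "Lp_norm M p (f - h) \<le> Lp_norm M p (f - g) + Lp_norm M p (g - h)"
  using Lp_norm_triangle[of "f - g" "g - h"] assms by (simp add: Lp_diff)

subsection \<open>The norm topology\<close>

lemma Lp_dist_eq:
  fixes f g :: "'a \<Rightarrow> 'e::{banach,second_countable_topology}"
  shows "Lp_dist M p f g = Lp_norm M p (f - g)"
  by (simp add: Lp_dist_def Lp_norm_def)

lemma openin_Lp_top_iff:
  fixes U :: "('a \<Rightarrow> 'e::{banach,second_countable_topology}) set"
  shows "openin (Lp_top M p) U \<longleftrightarrow> U \<subseteq> Lp M p \<and>
      (\<forall>f\<in>U. \<exists>e>0. \<forall>g\<in>Lp M p. Lp_norm M p (f - g) < e \<longrightarrow> g \<in> U)"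
proof -
  have "istopology (\<lambda>U. U \<subseteq> Lp M p \<and>
      (\<forall>f\<in>U. \<exists>e>0. \<forall>g\<in>Lp M p. Lp_dist M p f g < e \<longrightarrow> g \<in> (U :: ('a \<Rightarrow> 'e) set)))"
    unfolding istopology_def
  proof (intro conjI allI impI)
    fix S T :: "('a \<Rightarrow> 'e) set"
    assume S: "S \<subseteq> Lp M p \<and> (\<forall>f\<in>S. \<exists>e>0. \<forall>g\<in>Lp M p. Lp_dist M p f g < e \<longrightarrow> g \<in> S)"
      and T: "T \<subseteq> Lp M p \<and> (\<forall>f\<in>T. \<exists>e>0. \<forall>g\<in>Lp M p. Lp_dist M p f g < e \<longrightarrow> g \<in> T)"
    show "\<forall>f\<in>S \<inter> T. \<exists>e>0. \<forall>g\<in>Lp M p. Lp_dist M p f g < e \<longrightarrow> g \<in> S \<inter> T"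
    proof
      fix f assume "f \<in> S \<inter> T"
      then obtain d e where "d > 0" "\<forall>g\<in>Lp M p. Lp_dist M p f g < d \<longrightarrow> g \<in> S"
          "e > 0" "\<forall>g\<in>Lp M p. Lp_dist M p f g < e \<longrightarrow> g \<in> T"
        using S T by blast
      then show "\<exists>e>0. \<forall>g\<in>Lp M p. Lp_dist M p f g < e \<longrightarrow> g \<in> S \<inter> T"
        by (intro exI[of _ "min d e"]) auto
    qed
  next
    fix \<K> :: "('a \<Rightarrow> 'e) set set"
    assume K: "\<forall>U\<in>\<K>. U \<subseteq> Lp M p \<and> (\<forall>f\<in>U. \<exists>e>0. \<forall>g\<in>Lp M p. Lp_dist M p f g < e \<longrightarrow> g \<in> U)"
    show "\<Union> \<K> \<subseteq> Lp M p" using K by blast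
    show "\<forall>f\<in>\<Union> \<K>. \<exists>e>0. \<forall>g\<in>Lp M p. Lp_dist M p f g < e \<longrightarrow> g \<in> \<Union> \<K>"
      using K by (meson UnionE UnionI)
  qed auto
  then show ?thesis by (simp add: Lp_top_def Lp_dist_eq)
qed

lemma topspace_Lp_top [simp]: "topspace (Lp_top M p) = Lp M p"
proof (rule antisym)
  show "topspace (Lp_top M p) \<subseteq> Lp M p"
    using openin_topspace[of "Lp_top M p"] unfolding openin_Lp_top_iff by blast
  have "openin (Lp_top M p) (Lp M p)"
    unfolding openin_Lp_top_iff by (auto intro: exI[of _ 1])
  then show "Lp M p \<subseteq> topspace (Lp_top M p)" by (rule openin_subset)
qed

lemma openin_Lp_ball:
  fixes f :: "'a \<Rightarrow> 'e::{banach,second_countable_topology}"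
  assumes f: "f \<in> Lp M p"
  shows "openin (Lp_top M p) {g \<in> Lp M p. Lp_norm M p (f - g) < e}"
  unfolding openin_Lp_top_iff
proof (intro conjI ballI)
  fix g assume g: "g \<in> {g \<in> Lp M p. Lp_norm M p (f - g) < e}"
  show "\<exists>d>0. \<forall>h\<in>Lp M p. Lp_norm M p (g - h) < d \<longrightarrow> h \<in> {g \<in> Lp M p. Lp_norm M p (f - g) < e}"
    using g Lp_norm_diff_triangle[OF f] by (intro exI[of _ "e - Lp_norm M p (f - g)"]) fastforce
qed auto

lemma in_Lp_cl_iff:
  fixes S :: "('a \<Rightarrow> 'e::{banach,second_countable_topology}) set"
  assumes S: "S \<subseteq> Lp M p"
  shows "f \<in> Lp_cl M p S \<longleftrightarrow> f \<in> Lp M p \<and> (\<forall>e>0. \<exists>g\<in>S. Lp_norm M p (f - g) < e)"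
proof
  assume f: "f \<in> Lp_cl M p S"
  then have fL: "f \<in> Lp M p" by (simp add: Lp_cl_def in_closure_of)
  have "\<exists>g\<in>S. Lp_norm M p (f - g) < e" if "e > 0" for e
  proof -
    have "f \<in> {g \<in> Lp M p. Lp_norm M p (f - g) < e}" (is "f \<in> ?B") using fL that by simp
    moreover have "openin (Lp_top M p) ?B" by (rule openin_Lp_ball[OF fL])
    moreover have "\<forall>T. f \<in> T \<and> openin (Lp_top M p) T \<longrightarrow> (\<exists>y. y \<in> S \<and> y \<in> T)"
      using f by (simp add: Lp_cl_def in_closure_of)
    ultimately have "\<exists>y. y \<in> S \<and> y \<in> ?B" by metis
    then show ?thesis by auto
  qed
  then show "f \<in> Lp M p \<and> (\<forall>e>0. \<exists>g\<in>S. Lp_norm M p (f - g) < e)" using fL by blast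
next
  assume f: "f \<in> Lp M p \<and> (\<forall>e>0. \<exists>g\<in>S. Lp_norm M p (f - g) < e)"
  show "f \<in> Lp_cl M p S"
    unfolding Lp_cl_def in_closure_of
  proof (intro conjI allI impI)
    fix T assume "f \<in> T \<and> openin (Lp_top M p) T"
    then obtain e where "e > 0" "\<forall>g\<in>Lp M p. Lp_norm M p (f - g) < e \<longrightarrow> g \<in> T"
      unfolding openin_Lp_top_iff by blast
    then show "\<exists>y. y \<in> S \<and> y \<in> T" using f S by blast
  qed (use f in simp)
qed

lemma closedin_LpI:
  fixes S :: "('a \<Rightarrow> 'e::{banach,second_countable_topology}) set"
  assumes "S \<subseteq> Lp M p" "\<And>f. f \<in> Lp M p \<Longrightarrow> (\<And>e. e > 0 \<Longrightarrow> \<exists>g\<in>S. Lp_norm M p (f - g) < e) \<Longrightarrow> f \<in> S"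
  shows "closedin (Lp_top M p) S"
proof -
  have "Lp_cl M p S \<subseteq> S" using assms in_Lp_cl_iff[OF assms(1)] by blast
  then show ?thesis using assms(1) by (simp add: Lp_cl_def closure_of_subset_eq[symmetric])
qed

lemma closedin_LpD:
  fixes S :: "('a \<Rightarrow> 'e::{banach,second_countable_topology}) set"
  assumes "closedin (Lp_top M p) S" "f \<in> Lp M p" "\<And>e. e > 0 \<Longrightarrow> \<exists>g\<in>S. Lp_norm M p (f - g) < e"
  shows "f \<in> S"
proof -
  have S: "S \<subseteq> Lp M p" using closedin_subset[OF assms(1)] by simp
  have "f \<in> Lp_cl M p S" using assms(2,3) in_Lp_cl_iff[OF S] by blast
  then show ?thesis using closure_of_closedin[OF assms(1)] by (simp add: Lp_cl_def)
qed

lemma closedin_Lp_cl: "closedin (Lp_top M p) (Lp_cl M p S)"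
  by (simp add: Lp_cl_def)

lemma Lp_cl_minimal: "A \<subseteq> S \<Longrightarrow> closedin (Lp_top M p) S \<Longrightarrow> Lp_cl M p A \<subseteq> S"
  unfolding Lp_cl_def by (rule closure_of_minimal)

lemma Lp_cl_subset: "A \<subseteq> Lp M p \<Longrightarrow> A \<subseteq> Lp_cl M p A"
  unfolding Lp_cl_def by (simp add: closure_of_subset)

lemma Lp_cl_mono: "A \<subseteq> B \<Longrightarrow> Lp_cl M p A \<subseteq> Lp_cl M p B"
  unfolding Lp_cl_def by (rule closure_of_mono)

lemma closedin_Lp_subset: "closedin (Lp_top M p) S \<Longrightarrow> S \<subseteq> Lp M p"
  using closedin_subset by fastforce

lemma Lp_norm_diff_AE_eq:
  fixes f g :: "'a \<Rightarrow> 'e::{banach,second_countable_topology}"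
  assumes "f \<in> Lp M p" "g \<in> Lp M p" "AE w in M. f w = g w"
  shows "Lp_norm M p (f - g) = 0"
  using Lp_norm_cong_AE[of "f - g" 0, OF Lp_measurable[OF Lp_diff[OF assms(1,2)]] Lp_measurable[OF Lp_zero]] assms(3)
  by simp

text \<open>Almost everywhere equal functions have distance 0, so a closed set contains both or
  neither. Every closed set therefore represents a set of a.s.-classes.\<close>

lemma closedin_Lp_AE_cong:
  fixes f g :: "'a \<Rightarrow> 'e::{banach,second_countable_topology}"
  assumes "closedin (Lp_top M p) S" "f \<in> S" "g \<in> Lp M p" "AE w in M. f w = g w"
  shows "g \<in> S"
proof (rule closedin_LpD[OF assms(1,3)])
  have "Lp_norm M p (f - g) = 0"
    using assms closedin_Lp_subset by (intro Lp_norm_diff_AE_eq) auto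
  then show "\<exists>h\<in>S. Lp_norm M p (g - h) < e" if "e > 0" for e
    using that assms(2) by (metis Lp_norm_minus_commute)
qed

lemma closedin_Lp_sets: "closedin (Lp_top M p) S \<Longrightarrow> S \<in> Lp_sets M p"
  unfolding Lp_sets_def ae_closed_def
  using closedin_Lp_AE_cong closedin_Lp_subset by blast

lemma convex_Lp_cl:
  fixes S :: "('a \<Rightarrow> 'e::{banach,second_countable_topology}) set"
  assumes S: "S \<subseteq> Lp M p" and "convex S"
  shows "convex (Lp_cl M p S)"
proof (rule convexI)
  fix f g :: "'a \<Rightarrow> 'e" and u v :: real
  assume f: "f \<in> Lp_cl M p S" and g: "g \<in> Lp_cl M p S" and uv: "0 \<le> u" "0 \<le> v" "u + v = 1"
  have L: "f \<in> Lp M p" "g \<in> Lp M p" using f g by (auto simp: in_Lp_cl_iff[OF S])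
  have "\<exists>h\<in>S. Lp_norm M p (u *\<^sub>R f + v *\<^sub>R g - h) < e" if e: "e > 0" for e
  proof -
    obtain f' where f': "f' \<in> S" "Lp_norm M p (f - f') < e"
      using f e unfolding in_Lp_cl_iff[OF S] by blast
    obtain g' where g': "g' \<in> S" "Lp_norm M p (g - g') < e"
      using g e unfolding in_Lp_cl_iff[OF S] by blast
    note h = f' g'
    have d: "f - f' \<in> Lp M p" "g - g' \<in> Lp M p" using h S L by (auto intro: Lp_diff)
    have "u *\<^sub>R f + v *\<^sub>R g - (u *\<^sub>R f' + v *\<^sub>R g') = u *\<^sub>R (f - f') + v *\<^sub>R (g - g')"
      by (simp add: algebra_simps)
    then have "Lp_norm M p (u *\<^sub>R f + v *\<^sub>R g - (u *\<^sub>R f' + v *\<^sub>R g'))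
        \<le> u * Lp_norm M p (f - f') + v * Lp_norm M p (g - g')"
      using Lp_norm_triangle[OF Lp_scaleR[OF d(1), of u] Lp_scaleR[OF d(2), of v]] uv
      by (simp add: Lp_norm_scaleR)
    also have "\<dots> < e" by (rule convex_bound_lt[OF h(2,4) uv])
    finally show ?thesis using h \<open>convex S\<close> uv by (metis convexD)
  qed
  then show "u *\<^sub>R f + v *\<^sub>R g \<in> Lp_cl M p S"
    using Lp_convex_comb[OF L] by (simp add: in_Lp_cl_iff[OF S])
qed

end

section \<open>Decomposable sets\<close>

text \<open>Gluing two functions is enough; finite partitions follow by induction. Outside
  \<open>space M\<close> the glued function takes the values of \<open>g\<close>.\<close>

definition decomposable :: "'a measure \<Rightarrow> ('a \<Rightarrow> 'e) set \<Rightarrow> bool" where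
  "decomposable M S \<longleftrightarrow> (\<forall>f\<in>S. \<forall>g\<in>S. \<forall>B\<in>sets M. (\<lambda>w. if w \<in> B then f w else g w) \<in> S)"

lemma decomposableD:
  "decomposable M S \<Longrightarrow> f \<in> S \<Longrightarrow> g \<in> S \<Longrightarrow> B \<in> sets M \<Longrightarrow> (\<lambda>w. if w \<in> B then f w else g w) \<in> S"
  by (simp add: decomposable_def)

text \<open>A measurable index function replaces the partition, so that gluing and truncating become
  operations on indices. The value 0 outside \<open>space M\<close> is that of a sum of vanishing
  indicators.\<close>

lemma Lp_dec_iff_index:
  fixes A :: "('a \<Rightarrow> 'e::real_vector) set"
  shows "f \<in> Lp_dec M A \<longleftrightarrow> (\<exists>N m \<xi>. N \<in> measurable M (count_space UNIV) \<and> (\<forall>w\<in>space M. N w < (m::nat)) \<and>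
    (\<forall>i<m. \<xi> i \<in> A) \<and> f = (\<lambda>w. if w \<in> space M then \<xi> (N w) w else 0))"
proof
  assume "f \<in> Lp_dec M A"
  then obtain m :: nat and B \<xi> where f: "f = (\<lambda>w. \<Sum>i<m. indicator (B i) w *\<^sub>R \<xi> i w)"
    and B\<xi>: "\<forall>i<m. B i \<in> sets M \<and> \<xi> i \<in> A"
    and disj: "disjoint_family_on B {..<m}" and un: "(\<Union>i<m. B i) = space M"
    unfolding Lp_dec_def by blast
  note B = B\<xi>[rule_format, THEN conjunct1] and \<xi> = B\<xi>[rule_format, THEN conjunct2]
  define N where "N = (\<lambda>w. LEAST i. i < m \<and> w \<in> B i)"
  have pred: "Measurable.pred M (\<lambda>w. i < m \<and> w \<in> B i)" for i
    proof (cases "i < m")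
    case True
    then have Bi: "B i \<in> sets M" by (rule B)
    have "{w \<in> space M. i < m \<and> w \<in> B i} = B i" using True sets.sets_into_space[OF Bi] by blast
    then show ?thesis unfolding pred_def by (simp only: Bi)
  qed simp
  have "N \<in> measurable M (count_space UNIV)" unfolding N_def by (intro measurable_Least pred)
  moreover have N: "N w < m \<and> w \<in> B (N w)" if "w \<in> space M" for w
  proof -
    have "w \<in> (\<Union>i<m. B i)" using that by (simp only: un)
    then obtain i where "i < m \<and> w \<in> B i" by blast
    then show ?thesis unfolding N_def by (rule LeastI)
  qed
  moreover have "f = (\<lambda>w. if w \<in> space M then \<xi> (N w) w else 0)"
  proof
    fix w
    show "f w = (if w \<in> space M then \<xi> (N w) w else 0)"
    proof (cases "w \<in> space M")
      case True
      have "indicator (B i) w *\<^sub>R \<xi> i w = (if i = N w then \<xi> i w else 0)" if "i < m" for i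
        using N[OF True] that disj unfolding disjoint_family_on_def
        by (cases "i = N w") (auto simp: indicator_def)
      then have "f w = (\<Sum>i<m. if i = N w then \<xi> i w else 0)" unfolding f by (intro sum.cong) auto
      then show ?thesis using True N[OF True] by simp
    next
      case False
      then have "w \<notin> (\<Union>i<m. B i)" by (simp only: un not_False_eq_True)
      then have "f w = (\<Sum>i<m. 0)" unfolding f by (intro sum.cong) auto
      then show ?thesis using False by simp
    qed
  qed
  ultimately show "\<exists>N m \<xi>. N \<in> measurable M (count_space UNIV) \<and> (\<forall>w\<in>space M. N w < (m::nat)) \<and>
    (\<forall>i<m. \<xi> i \<in> A) \<and> f = (\<lambda>w. if w \<in> space M then \<xi> (N w) w else 0)"
    using \<xi> by (intro exI[of _ N] exI[of _ m] exI[of _ \<xi>]) blast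
next
  assume "\<exists>N m \<xi>. N \<in> measurable M (count_space UNIV) \<and> (\<forall>w\<in>space M. N w < (m::nat)) \<and>
    (\<forall>i<m. \<xi> i \<in> A) \<and> f = (\<lambda>w. if w \<in> space M then \<xi> (N w) w else 0)"
  then obtain N m \<xi> where [measurable]: "N \<in> measurable M (count_space UNIV)"
    and N: "\<And>w. w \<in> space M \<Longrightarrow> N w < (m::nat)" and \<xi>: "\<And>i. i < m \<Longrightarrow> \<xi> i \<in> A"
    and f: "f = (\<lambda>w. if w \<in> space M then \<xi> (N w) w else 0)"
    by blast
  define B where "B i = {w \<in> space M. N w = i}" for i
  have "f = (\<lambda>w. \<Sum>i<m. indicator (B i) w *\<^sub>R \<xi> i w)"
  proof
    fix w
    show "f w = (\<Sum>i<m. indicator (B i) w *\<^sub>R \<xi> i w)"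
    proof (cases "w \<in> space M")
      case True
      then have "(\<Sum>i<m. indicator (B i) w *\<^sub>R \<xi> i w) = (\<Sum>i<m. if i = N w then \<xi> i w else 0)"
        by (intro sum.cong) (auto simp: B_def indicator_def)
      then show ?thesis using True N by (simp add: f)
    qed (simp add: f B_def)
  qed
  moreover have "B i \<in> sets M" for i unfolding B_def by measurable
  moreover have "disjoint_family_on B {..<m}" by (auto simp: disjoint_family_on_def B_def)
  moreover have "(\<Union>i<m. B i) = space M" using N by (auto simp: B_def)
  ultimately show "f \<in> Lp_dec M A" unfolding Lp_dec_def using \<xi> by blast
qed

lemma decomposable_Lp_dec:
  fixes A :: "('a \<Rightarrow> 'e::real_vector) set"
  shows "decomposable M (Lp_dec M A)"
  unfolding decomposable_def
proof (intro ballI)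
  fix f g :: "'a \<Rightarrow> 'e" and B assume f: "f \<in> Lp_dec M A" and g: "g \<in> Lp_dec M A" and [measurable]: "B \<in> sets M"
  obtain N m \<xi> where [measurable]: "N \<in> measurable M (count_space UNIV)"
    and N: "\<forall>w\<in>space M. N w < (m::nat)" and \<xi>: "\<forall>i<m. \<xi> i \<in> A"
    and feq: "f = (\<lambda>w. if w \<in> space M then \<xi> (N w) w else 0)"
    using f unfolding Lp_dec_iff_index by blast
  obtain N' m' \<xi>' where [measurable]: "N' \<in> measurable M (count_space UNIV)"
    and N': "\<forall>w\<in>space M. N' w < (m'::nat)" and \<xi>': "\<forall>i<m'. \<xi>' i \<in> A"
    and geq: "g = (\<lambda>w. if w \<in> space M then \<xi>' (N' w) w else 0)"
    using g unfolding Lp_dec_iff_index by blast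
  show "(\<lambda>w. if w \<in> B then f w else g w) \<in> Lp_dec M A"
    unfolding Lp_dec_iff_index
  proof (intro exI conjI)
    show "(\<lambda>w. if w \<in> B then N w else m + N' w) \<in> measurable M (count_space UNIV)" by measurable
    show "\<forall>w\<in>space M. (if w \<in> B then N w else m + N' w) < m + m'" using N N' by auto
    show "\<forall>i<m + m'. (if i < m then \<xi> i else \<xi>' (i - m)) \<in> A" using \<xi> \<xi>' by auto
    show "(\<lambda>w. if w \<in> B then f w else g w) = (\<lambda>w. if w \<in> space M then
       (if (if w \<in> B then N w else m + N' w) < m then \<xi> (if w \<in> B then N w else m + N' w)
         else \<xi>' ((if w \<in> B then N w else m + N' w) - m)) w else 0)"
      using N N' by (auto simp: fun_eq_iff feq geq)
  qed
qed

context Lp_space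
begin

lemma Lp_dec_subset_decomposable:
  fixes A S :: "('a \<Rightarrow> 'e::{banach,second_countable_topology}) set"
  assumes "A \<subseteq> S" and dec: "decomposable M S" and S: "S \<in> Lp_sets M p"
  shows "Lp_dec M A \<subseteq> S"
proof
  fix f assume "f \<in> Lp_dec M A"
  then obtain N m \<xi> where [measurable]: "N \<in> measurable M (count_space UNIV)"
    and N: "\<forall>w\<in>space M. N w < (m::nat)" and \<xi>: "\<forall>i<m. \<xi> i \<in> A"
    and feq: "f = (\<lambda>w. if w \<in> space M then \<xi> (N w) w else 0)"
    unfolding Lp_dec_iff_index by blast
  obtain w where "w \<in> space M" using not_empty by blast
  then have m: "m > 0" using N by fastforce
  \<comment> \<open>Capping the index at \<open>k\<close> makes each induction step a single gluing,
    of the previous function on \<open>N w \<le> k\<close> with \<open>\<xi> (Suc k)\<close>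
    elsewhere.\<close>
  have step: "k < m \<Longrightarrow> \<exists>h\<in>S. \<forall>w\<in>space M. h w = \<xi> (min (N w) k) w" for k
  proof (induction k)
    case 0
    then show ?case using \<xi> \<open>A \<subseteq> S\<close> by (intro bexI[of _ "\<xi> 0"]) auto
  next
    case (Suc k)
    then obtain h where h: "h \<in> S" "\<forall>w\<in>space M. h w = \<xi> (min (N w) k) w" by auto
    have "(\<lambda>w. if w \<in> {w \<in> space M. N w \<le> k} then h w else \<xi> (Suc k) w) \<in> S"
      using Suc.prems \<xi> \<open>A \<subseteq> S\<close> h(1) by (intro decomposableD[OF dec]) auto
    then show ?case
      using h(2) by (intro bexI[of _ "\<lambda>w. if w \<in> {w \<in> space M. N w \<le> k} then h w else \<xi> (Suc k) w"])
        (auto simp: min_def le_Suc_eq)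
  qed
  obtain h where h: "h \<in> S" "\<forall>w\<in>space M. h w = \<xi> (min (N w) (m - 1)) w" using step[of "m - 1"] m by auto
  have eq: "h w = f w" if "w \<in> space M" for w
  proof -
    have "N w \<le> m - 1" using that N m by fastforce
    then show ?thesis using that h(2) by (simp add: feq min_absorb1)
  qed
  \<comment> \<open>The functions \<open>h\<close> and \<open>f\<close> may differ outside
    \<open>space M\<close>. Cutting off there shows \<open>f\<close> to be in \<open>Lp M p\<close>,
    and saturation of \<open>S\<close> then applies.\<close>
  have "(\<lambda>w. if w \<in> space M then h w else 0 w) \<in> Lp M p"
    by (rule Lp_if[OF _ Lp_zero]) (use h(1) S in \<open>auto simp: Lp_sets_def\<close>)
  also have "(\<lambda>w. if w \<in> space M then h w else 0 w) = f"
    using eq by (auto simp: feq)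
  finally show "f \<in> S" using S h(1) eq unfolding Lp_sets_def ae_closed_def by (auto intro: AE_I2)
qed

lemma Lp_sets_Lp: "Lp M p \<in> Lp_sets M p"
  by (simp add: Lp_sets_def ae_closed_def)

lemma decomposable_Lp: "decomposable M (Lp M p)"
  by (simp add: decomposable_def Lp_if)

lemma Lp_dec_subset_Lp:
  fixes A :: "('a \<Rightarrow> 'e::{banach,second_countable_topology}) set"
  shows "A \<subseteq> Lp M p \<Longrightarrow> Lp_dec M A \<subseteq> Lp M p"
  by (rule Lp_dec_subset_decomposable[OF _ decomposable_Lp Lp_sets_Lp])

text \<open>The difference of two glued functions is the sum of the two differences, each cut off to
  its piece. This makes gluing continuous in each argument.\<close>

lemma Lp_norm_if_le:
  fixes f g f' g' :: "'a \<Rightarrow> 'e::{banach,second_countable_topology}"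
  assumes L: "f \<in> Lp M p" "g \<in> Lp M p" "f' \<in> Lp M p" "g' \<in> Lp M p" and B: "B \<in> sets M"
  shows "Lp_norm M p ((\<lambda>w. if w \<in> B then f w else g w) - (\<lambda>w. if w \<in> B then f' w else g' w))
    \<le> Lp_norm M p (f - f') + Lp_norm M p (g - g')"
proof -
  have d: "f - f' \<in> Lp M p" "g - g' \<in> Lp M p" using L by (auto intro: Lp_diff)
  have i: "(\<lambda>w. if w \<in> B then (f - f') w else 0 w) \<in> Lp M p" "(\<lambda>w. if w \<in> B then 0 w else (g - g') w) \<in> Lp M p"
    using d B Lp_zero by (auto intro: Lp_if)
  have "((\<lambda>w. if w \<in> B then f w else g w) - (\<lambda>w. if w \<in> B then f' w else g' w))
      = (\<lambda>w. if w \<in> B then (f - f') w else 0 w) + (\<lambda>w. if w \<in> B then 0 w else (g - g') w)"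
    by (auto simp: fun_eq_iff)
  then have "Lp_norm M p ((\<lambda>w. if w \<in> B then f w else g w) - (\<lambda>w. if w \<in> B then f' w else g' w))
    \<le> Lp_norm M p (\<lambda>w. if w \<in> B then (f - f') w else 0 w) + Lp_norm M p (\<lambda>w. if w \<in> B then 0 w else (g - g') w)"
    using Lp_norm_triangle[OF i] by simp
  also have "\<dots> \<le> Lp_norm M p (f - f') + Lp_norm M p (g - g')"
    by (intro add_mono Lp_norm_mono i d) auto
  finally show ?thesis .
qed

lemma decomposable_Lp_cl:
  fixes S :: "('a \<Rightarrow> 'e::{banach,second_countable_topology}) set"
  assumes S: "S \<subseteq> Lp M p" and dec: "decomposable M S"
  shows "decomposable M (Lp_cl M p S)"
  unfolding decomposable_def
proof (intro ballI)
  fix f g :: "'a \<Rightarrow> 'e" and B assume f: "f \<in> Lp_cl M p S" and g: "g \<in> Lp_cl M p S" and B: "B \<in> sets M"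
  have L: "f \<in> Lp M p" "g \<in> Lp M p" using f g by (auto simp: in_Lp_cl_iff[OF S])
  have "\<exists>h\<in>S. Lp_norm M p ((\<lambda>w. if w \<in> B then f w else g w) - h) < e" if e: "e > 0" for e
  proof -
    obtain f' where f': "f' \<in> S" "Lp_norm M p (f - f') < e / 2"
      using f half_gt_zero[OF e] unfolding in_Lp_cl_iff[OF S] by blast
    obtain g' where g': "g' \<in> S" "Lp_norm M p (g - g') < e / 2"
      using g half_gt_zero[OF e] unfolding in_Lp_cl_iff[OF S] by blast
    have L': "f' \<in> Lp M p" "g' \<in> Lp M p" using f' g' S by auto
    show ?thesis
      using Lp_norm_if_le[OF L L' B] f'(2) g'(2) decomposableD[OF dec f'(1) g'(1) B]
      by (intro bexI[of _ "\<lambda>w. if w \<in> B then f' w else g' w"]) auto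
  qed
  then show "(\<lambda>w. if w \<in> B then f w else g w) \<in> Lp_cl M p S"
    unfolding in_Lp_cl_iff[OF S] using Lp_if[OF L B] by blast
qed

lemma decomposable_Lp_cl_dec:
  fixes A :: "('a \<Rightarrow> 'e::{banach,second_countable_topology}) set"
  shows "A \<subseteq> Lp M p \<Longrightarrow> decomposable M (Lp_cl M p (Lp_dec M A))"
  by (intro decomposable_Lp_cl decomposable_Lp_dec Lp_dec_subset_Lp)

lemma Lp_cl_dec_minimal:
  fixes A S :: "('a \<Rightarrow> 'e::{banach,second_countable_topology}) set"
  assumes "A \<subseteq> S" "decomposable M S" "closedin (Lp_top M p) S"
  shows "Lp_cl M p (Lp_dec M A) \<subseteq> S"
  using Lp_dec_subset_decomposable[OF assms(1,2) closedin_Lp_sets[OF assms(3)]] assms(3) by (rule Lp_cl_minimal)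

text \<open>A member of \<open>A\<close> that is nonzero somewhere outside \<open>space M\<close> is
  not itself a decomposition. Its cut-off is one, and the closure contains all
  representatives.\<close>

lemma subset_Lp_cl_dec:
  fixes A :: "('a \<Rightarrow> 'e::{banach,second_countable_topology}) set"
  assumes A: "A \<subseteq> Lp M p"
  shows "A \<subseteq> Lp_cl M p (Lp_dec M A)"
proof
  fix f assume f: "f \<in> A"
  have d: "(\<lambda>w. if w \<in> space M then f w else 0) \<in> Lp_dec M A"
    unfolding Lp_dec_iff_index using f
    by (intro exI[of _ "\<lambda>w. 0"] exI[of _ 1] exI[of _ "\<lambda>i. f"]) auto
  then have "(\<lambda>w. if w \<in> space M then f w else 0) \<in> Lp_cl M p (Lp_dec M A)"
    using Lp_cl_subset[OF Lp_dec_subset_Lp[OF A]] by blast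
  then show "f \<in> Lp_cl M p (Lp_dec M A)"
    using f A by (elim closedin_Lp_AE_cong[OF closedin_Lp_cl]) (auto intro: AE_I2)
qed

lemma Lp_cl_dec_eq:
  fixes S :: "('a \<Rightarrow> 'e::{banach,second_countable_topology}) set"
  assumes "decomposable M S" "closedin (Lp_top M p) S"
  shows "Lp_cl M p (Lp_dec M S) = S"
  using Lp_cl_dec_minimal[OF order_refl assms] subset_Lp_cl_dec[OF closedin_Lp_subset[OF assms(2)]] by blast

section \<open>Convexity of closed decomposable hulls and decomposability of closed convex
  hulls\<close>

lemma closedin_affine_preimage:
  fixes g :: "'a \<Rightarrow> 'e::{banach,second_countable_topology}"
  assumes Q: "closedin (Lp_top M p) Q" and g: "g \<in> Lp M p"
  shows "closedin (Lp_top M p) {f \<in> Lp M p. a *\<^sub>R f + b *\<^sub>R g \<in> Q}" (is "closedin _ ?T")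
proof (rule closedin_LpI)
  fix f :: "'a \<Rightarrow> 'e" assume f: "f \<in> Lp M p" and app: "\<And>e. e > 0 \<Longrightarrow> \<exists>h\<in>?T. Lp_norm M p (f - h) < e"
  have "a *\<^sub>R f + b *\<^sub>R g \<in> Q"
  proof (rule closedin_LpD[OF Q Lp_convex_comb[OF f g]])
    fix e :: real assume e: "e > 0"
    \<comment> \<open>The summand 1 keeps the denominator positive when
      \<open>a = 0\<close>.\<close>
    then have "e / (\<bar>a\<bar> + 1) > 0" by simp
    from app[OF this] obtain h where h: "h \<in> ?T" "Lp_norm M p (f - h) < e / (\<bar>a\<bar> + 1)" by blast
    have "a *\<^sub>R f + b *\<^sub>R g - (a *\<^sub>R h + b *\<^sub>R g) = a *\<^sub>R (f - h)" by (simp add: algebra_simps)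
    then have "Lp_norm M p (a *\<^sub>R f + b *\<^sub>R g - (a *\<^sub>R h + b *\<^sub>R g)) = \<bar>a\<bar> * Lp_norm M p (f - h)"
      by (simp add: Lp_norm_scaleR)
    also have "\<dots> \<le> (\<bar>a\<bar> + 1) * Lp_norm M p (f - h)" by (intro mult_right_mono) auto
    also have "\<dots> < e" using h(2) by (simp add: pos_less_divide_eq mult.commute)
    finally show "\<exists>h\<in>Q. Lp_norm M p (a *\<^sub>R f + b *\<^sub>R g - h) < e" using h(1) by blast
  qed
  then show "f \<in> ?T" using f by blast
qed auto

lemma decomposable_affine_preimage:
  fixes g :: "'a \<Rightarrow> 'e::{banach,second_countable_topology}"
  assumes Q: "decomposable M Q"
  shows "decomposable M {f \<in> Lp M p. a *\<^sub>R f + b *\<^sub>R g \<in> Q}"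
  unfolding decomposable_def
proof (intro ballI)
  fix f h B assume f: "f \<in> {f \<in> Lp M p. a *\<^sub>R f + b *\<^sub>R g \<in> Q}" "h \<in> {f \<in> Lp M p. a *\<^sub>R f + b *\<^sub>R g \<in> Q}" "B \<in> sets M"
  have "a *\<^sub>R (\<lambda>w. if w \<in> B then f w else h w) + b *\<^sub>R g
      = (\<lambda>w. if w \<in> B then (a *\<^sub>R f + b *\<^sub>R g) w else (a *\<^sub>R h + b *\<^sub>R g) w)"
    by (auto simp: fun_eq_iff)
  also have "\<dots> \<in> Q"
  proof (rule decomposableD[OF Q])
    show "a *\<^sub>R f + b *\<^sub>R g \<in> Q" "a *\<^sub>R h + b *\<^sub>R g \<in> Q" "B \<in> sets M" using f by blast+
  qed
  finally show "(\<lambda>w. if w \<in> B then f w else h w) \<in> {f \<in> Lp M p. a *\<^sub>R f + b *\<^sub>R g \<in> Q}"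
    using f Lp_if[of f h B] by simp
qed

lemma convex_Lp_cl_dec:
  fixes A :: "('a \<Rightarrow> 'e::{banach,second_countable_topology}) set"
  assumes A: "A \<subseteq> Lp M p" and cvx: "convex A"
  shows "convex (Lp_cl M p (Lp_dec M A))" (is "convex ?Q")
proof (rule convexI)
  fix f g :: "'a \<Rightarrow> 'e" and u v :: real
  assume f: "f \<in> ?Q" and g: "g \<in> ?Q" and uv: "0 \<le> u" "0 \<le> v" "u + v = 1"
  note Q = decomposable_Lp_cl_dec[OF A] closedin_Lp_cl[of "Lp_dec M A"]
  have fL: "f \<in> Lp M p" using f closedin_Lp_subset[OF Q(2)] by blast
  \<comment> \<open>The second point stays in \<open>A\<close> while the first is extended from
    \<open>A\<close> to the hull; afterwards the first is fixed in the hull and the second is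
    extended.\<close>
  have 1: "u *\<^sub>R f + v *\<^sub>R h \<in> ?Q" if h: "h \<in> A" for h
  proof -
    have "A \<subseteq> {f \<in> Lp M p. u *\<^sub>R f + v *\<^sub>R h \<in> ?Q}"
      using A h uv convexD[OF cvx] subset_Lp_cl_dec[OF A] by blast
    then have "?Q \<subseteq> {f \<in> Lp M p. u *\<^sub>R f + v *\<^sub>R h \<in> ?Q}"
      using A h by (intro Lp_cl_dec_minimal decomposable_affine_preimage closedin_affine_preimage Q) auto
    then show ?thesis using f by blast
  qed
  have "A \<subseteq> {h \<in> Lp M p. v *\<^sub>R h + u *\<^sub>R f \<in> ?Q}"
    using 1 A by (auto simp: add.commute)
  then have "?Q \<subseteq> {h \<in> Lp M p. v *\<^sub>R h + u *\<^sub>R f \<in> ?Q}"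
    using fL by (intro Lp_cl_dec_minimal decomposable_affine_preimage closedin_affine_preimage Q)
  then show "u *\<^sub>R f + v *\<^sub>R g \<in> ?Q" using g by (auto simp: add.commute)
qed

lemma Lp_cl_convex_hull_minimal:
  fixes A S :: "('a \<Rightarrow> 'e::{banach,second_countable_topology}) set"
  assumes "A \<subseteq> S" "convex S" "closedin (Lp_top M p) S"
  shows "Lp_cl M p (convex hull A) \<subseteq> S"
  using hull_minimal[of A S convex, OF assms(1,2)] assms(3) by (rule Lp_cl_minimal)

lemma convex_hull_subset_Lp:
  fixes A :: "('a \<Rightarrow> 'e::{banach,second_countable_topology}) set"
  shows "A \<subseteq> Lp M p \<Longrightarrow> convex hull A \<subseteq> Lp M p"
  by (intro hull_minimal subspace_imp_convex subspace_Lp)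

lemma decomposable_Lp_cl_convex_hull:
  fixes S :: "('a \<Rightarrow> 'e::{banach,second_countable_topology}) set"
  assumes S: "S \<subseteq> Lp M p" and dec: "decomposable M S"
  shows "decomposable M (Lp_cl M p (convex hull S))" (is "decomposable M ?C")
  unfolding decomposable_def
proof (intro ballI)
  fix f g :: "'a \<Rightarrow> 'e" and B assume f: "f \<in> ?C" and g: "g \<in> ?C" and B: "B \<in> sets M"
  have hS: "convex hull S \<subseteq> Lp M p" by (rule convex_hull_subset_Lp[OF S])
  have CL: "?C \<subseteq> Lp M p" by (rule closedin_Lp_subset[OF closedin_Lp_cl])
  have SC: "S \<subseteq> ?C" using hull_subset[of S convex] Lp_cl_subset[OF hS] by blast
  have C: "closedin (Lp_top M p) ?C" "convex ?C"
    by (rule closedin_Lp_cl, rule convex_Lp_cl[OF hS convex_convex_hull])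
  \<comment> \<open>For fixed \<open>k\<close> and \<open>B\<close>, gluing is affine and continuous
    in \<open>h\<close>, so its preimage of \<open>?C\<close> is closed and convex. The set
    \<open>B\<close> is left general because the second use is for its complement.\<close>
  have ext: "?C \<subseteq> {h \<in> Lp M p. (\<lambda>w. if w \<in> B then h w else k w) \<in> ?C}"
    if k: "k \<in> Lp M p" and sub: "S \<subseteq> {h \<in> Lp M p. (\<lambda>w. if w \<in> B then h w else k w) \<in> ?C}"
      and B: "B \<in> sets M" for k B
  proof (rule Lp_cl_convex_hull_minimal[OF sub])
    let ?T = "\<lambda>B k. {h \<in> Lp M p. (\<lambda>w. if w \<in> B then h w else k w) \<in> ?C}"
    show "convex (?T B k)"
    proof (rule convexI)
      fix a b :: "'a \<Rightarrow> 'e" and u v :: real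
      assume ab: "a \<in> ?T B k" "b \<in> ?T B k" and uv: "0 \<le> u" "0 \<le> v" "u + v = 1"
      have "u *\<^sub>R (\<lambda>w. if w \<in> B then a w else k w) + v *\<^sub>R (\<lambda>w. if w \<in> B then b w else k w) \<in> ?C"
        using ab uv by (intro convexD[OF C(2)]) auto
      also have "u *\<^sub>R (\<lambda>w. if w \<in> B then a w else k w) + v *\<^sub>R (\<lambda>w. if w \<in> B then b w else k w)
         = (\<lambda>w. if w \<in> B then (u *\<^sub>R a + v *\<^sub>R b) w else k w)"
        using uv(3) by (auto simp: fun_eq_iff scaleR_add_left[symmetric])
      finally show "u *\<^sub>R a + v *\<^sub>R b \<in> ?T B k" using ab Lp_convex_comb[of a b u v] by simp
    qed
    show "closedin (Lp_top M p) (?T B k)"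
    proof (rule closedin_LpI)
      fix h assume h: "h \<in> Lp M p" and app: "\<And>e. e > 0 \<Longrightarrow> \<exists>h'\<in>?T B k. Lp_norm M p (h - h') < e"
      have "(\<lambda>w. if w \<in> B then h w else k w) \<in> ?C"
      proof (rule closedin_LpD[OF C(1) Lp_if[OF h k B]])
        fix e :: real assume "e > 0"
        then obtain h' where h': "h' \<in> ?T B k" "Lp_norm M p (h - h') < e" using app by blast
        have "Lp_norm M p ((\<lambda>w. if w \<in> B then h w else k w) - (\<lambda>w. if w \<in> B then h' w else k w)) \<le> Lp_norm M p (h - h')"
          using Lp_norm_if_le[OF h k _ k B, of h'] h' by simp
        then show "\<exists>k'\<in>?C. Lp_norm M p ((\<lambda>w. if w \<in> B then h w else k w) - k') < e"
          using h' by (intro bexI[of _ "\<lambda>w. if w \<in> B then h' w else k w"]) auto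
      qed
      then show "h \<in> ?T B k" using h by blast
    qed auto
  qed
  have 1: "(\<lambda>w. if w \<in> B then f w else k w) \<in> ?C" if k: "k \<in> S" for k
  proof -
    have "S \<subseteq> {h \<in> Lp M p. (\<lambda>w. if w \<in> B then h w else k w) \<in> ?C}"
      using S SC decomposableD[OF dec _ k B] by blast
    from ext[OF _ this B] show ?thesis using k S f by blast
  qed
  \<comment> \<open>Passing to the complement exchanges the branches, so \<open>ext\<close> also
    extends the second argument. The two functions can differ only outside \<open>space M\<close>,
    which a closed set does not see.\<close>
  have compl: "(\<lambda>w. if w \<in> space M - B then h w else f w) \<in> ?C \<longleftrightarrow> (\<lambda>w. if w \<in> B then f w else h w) \<in> ?C"
    if h: "h \<in> Lp M p" for h
  proof -
    have L: "f \<in> Lp M p" using f CL by blast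
    have "(\<lambda>w. if w \<in> space M - B then h w else f w) \<in> Lp M p" "(\<lambda>w. if w \<in> B then f w else h w) \<in> Lp M p"
      by (rule Lp_if[OF h L], use B in simp) (rule Lp_if[OF L h B])
    moreover have "AE w in M. (if w \<in> space M - B then h w else f w) = (if w \<in> B then f w else h w)"
      by (auto intro!: AE_I2)
    moreover from this have "AE w in M. (if w \<in> B then f w else h w) = (if w \<in> space M - B then h w else f w)"
      by eventually_elim simp
    ultimately show ?thesis using closedin_Lp_AE_cong[OF C(1)] by blast
  qed
  have "S \<subseteq> {h \<in> Lp M p. (\<lambda>w. if w \<in> space M - B then h w else f w) \<in> ?C}"
    using 1 S compl by blast
  from ext[OF _ this] have "(\<lambda>w. if w \<in> space M - B then g w else f w) \<in> ?C" using f g B CL by blast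
  then show "(\<lambda>w. if w \<in> B then f w else g w) \<in> ?C" using compl g CL by blast
qed

subsection \<open>Sets of selections\<close>

lemma decomposable_Lp_sel:
  fixes X :: "'a \<Rightarrow> 'e::{banach,second_countable_topology} set"
  shows "decomposable M (Lp_sel M p X)"
  unfolding decomposable_def Lp_sel_def by (auto intro: Lp_if elim: eventually_elim2)

text \<open>An approximating sequence of selections has a subsequence converging almost everywhere,
  and closed values keep the limit.\<close>

lemma closedin_Lp_sel:
  fixes X :: "'a \<Rightarrow> 'e::{banach,second_countable_topology} set"
  assumes cl: "AE w in M. closed (X w)"
  shows "closedin (Lp_top M p) (Lp_sel M p X)"
proof (rule closedin_LpI)
  show "Lp_sel M p X \<subseteq> Lp M p" by (auto simp: Lp_sel_def)
  fix f :: "'a \<Rightarrow> 'e" assume f: "f \<in> Lp M p" and app: "\<And>e. e > 0 \<Longrightarrow> \<exists>g\<in>Lp_sel M p X. Lp_norm M p (f - g) < e"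
  have "\<forall>n. \<exists>g. g \<in> Lp_sel M p X \<and> Lp_norm M p (f - g) < 1 / real (Suc n)"
    using app by (meson of_nat_0_less_iff zero_less_Suc zero_less_divide_1_iff)
  then obtain g where g: "\<And>n. g n \<in> Lp_sel M p X" "\<And>n. Lp_norm M p (f - g n) < 1 / real (Suc n)" by metis
  have gL: "g n \<in> Lp M p" for n using g(1)[of n] by (simp add: Lp_sel_def)
  have gX: "AE w in M. \<forall>n. g n w \<in> X w" using g(1) by (simp add: Lp_sel_def AE_all_countable)
  define u where "u = (\<lambda>n w. norm ((f - g n) w) powr p)"
  have ui: "integrable M (u n)" for n unfolding u_def by (intro Lp_integrable Lp_diff f gL)
  have "(\<lambda>n. \<integral>w. norm (u n w) \<partial>M) \<longlonglongrightarrow> 0"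
  proof (rule tendsto_sandwich[OF _ _ tendsto_const])
    show "eventually (\<lambda>n. (\<integral>w. norm (u n w) \<partial>M) \<le> 1 / real (Suc n)) sequentially"
    proof (intro always_eventually allI)
      fix n
      have "(\<integral>w. norm (u n w) \<partial>M) = (\<integral>w. norm ((f - g n) w) powr p \<partial>M)" by (simp add: u_def)
      also have "\<dots> < (1 / real (Suc n)) powr p"
        using g(2)[of n] Lp_norm_less_iff[of "1 / real (Suc n)" "f - g n"] by simp
      \<comment> \<open>The base is at most 1, so raising the exponent from 1 to \<open>p\<close>
        does not increase the power.\<close>
      also have "\<dots> \<le> (1 / real (Suc n)) powr 1" using p_ge_1 by (intro powr_mono') auto
      finally show "(\<integral>w. norm (u n w) \<partial>M) \<le> 1 / real (Suc n)" by simp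
    qed
    show "(\<lambda>n. 1 / real (Suc n)) \<longlonglongrightarrow> 0" using LIMSEQ_inverse_real_of_nat by (simp add: inverse_eq_divide)
  qed auto
  from tendsto_L1_AE_subseq[OF ui this] obtain r :: "nat \<Rightarrow> nat"
    where r: "AE w in M. (\<lambda>n. u (r n) w) \<longlonglongrightarrow> 0" by blast
  have "AE w in M. f w \<in> X w"
    using r gX cl
  proof eventually_elim
    fix w assume lim: "(\<lambda>n. u (r n) w) \<longlonglongrightarrow> 0" and X: "\<forall>n. g n w \<in> X w" "closed (X w)"
    have "(\<lambda>n. u (r n) w powr (1 / p)) \<longlonglongrightarrow> 0 powr (1 / p)"
      using p_ge_1 by (intro tendsto_powr'[OF lim tendsto_const]) (auto simp: u_def)
    then have "(\<lambda>n. norm (f w - g (r n) w)) \<longlonglongrightarrow> 0"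
      using p_ge_1 by (simp add: u_def powr_powr)
    then have "(\<lambda>n. f w - (f w - g (r n) w)) \<longlonglongrightarrow> f w - 0"
      by (rule tendsto_diff[OF tendsto_const tendsto_norm_zero_cancel])
    then have "(\<lambda>n. g (r n) w) \<longlonglongrightarrow> f w" by simp
    with X(2) X(1)[rule_format] show "f w \<in> X w" by (rule closed_sequentially)
  qed
  then show "f \<in> Lp_sel M p X" using f by (simp add: Lp_sel_def)
qed

lemma convex_Lp_sel:
  fixes X :: "'a \<Rightarrow> 'e::{banach,second_countable_topology} set"
  assumes "AE w in M. convex (X w)"
  shows "convex (Lp_sel M p X)"
proof (rule convexI)
  fix f g and u v :: real assume "f \<in> Lp_sel M p X" "g \<in> Lp_sel M p X" and uv: "0 \<le> u" "0 \<le> v" "u + v = 1"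
  then have L: "f \<in> Lp M p" "g \<in> Lp M p" and "AE w in M. f w \<in> X w" "AE w in M. g w \<in> X w"
    by (auto simp: Lp_sel_def)
  from this(3,4) assms have "AE w in M. u *\<^sub>R f w + v *\<^sub>R g w \<in> X w"
    by eventually_elim (simp add: convexD uv)
  then show "u *\<^sub>R f + v *\<^sub>R g \<in> Lp_sel M p X" using Lp_convex_comb[OF L] by (simp add: Lp_sel_def)
qed


section \<open>The multifunction of a decomposable set\<close>

text \<open>An analogue of the essential supremum: up to null sets, countably many members of
  \<open>S\<close> account for the values of all of them. Their pointwise closure becomes the
  multifunction of \<open>S\<close>.\<close>

lemma decomposable_essential_closure:
  fixes S :: "('a \<Rightarrow> 'e::{banach,second_countable_topology}) set"
  assumes S: "S \<subseteq> Lp M p" "S \<noteq> {}" and dec: "decomposable M S"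
  obtains h :: "nat \<Rightarrow> 'a \<Rightarrow> 'e" where "\<And>n. h n \<in> S"
    "\<And>f. f \<in> S \<Longrightarrow> AE w in M. f w \<in> closure (range (\<lambda>n. h n w))"
proof -
  obtain BB :: "'e set set" where BB: "countable BB" "topological_basis BB"
    using ex_countable_basis by blast
  define U where "U = from_nat_into (insert {} BB)"
  have openU: "open (U i)" for i
    unfolding U_def using from_nat_into[of "insert {} BB" i] topological_basis_open[OF BB(2)] by auto
  have basis: "\<exists>i. y \<in> U i \<and> U i \<subseteq> V" if V: "open V" "y \<in> V" for y V
  proof -
    obtain V' where V': "V' \<in> BB" "y \<in> V'" "V' \<subseteq> V" using topological_basisE[OF BB(2) V] by metis
    moreover obtain i where "U i = V'"
      unfolding U_def using from_nat_into_surj[of "insert {} BB" V'] BB(1) V' by auto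
    ultimately show ?thesis by blast
  qed
  define P where "P = (\<lambda>i f. prob {w \<in> space M. f w \<in> U i})"
  have sets: "{w \<in> space M. f w \<in> U i} \<in> sets M" if "f \<in> S" for f i
    using measurable_sets[OF Lp_measurable[of f], of "U i"] that S openU[of i]
    by (auto simp: vimage_def Int_def conj_commute)
  have bdd: "bdd_above (P i ` S)" for i
    by (rule bdd_aboveI2[where M=1]) (simp add: P_def)
  \<comment> \<open>Decomposability makes the events \<open>f \<in> U i\<close> closed under unions, so a maximising sequence exhausts them.\<close>
  define s where "s i = (SUP f\<in>S. P i f)" for i
  have "\<exists>f\<in>S. P i f > s i - 1 / real (Suc j)" for i j
  proof -
    have "s i - 1 / real (Suc j) < s i" by simp
    then show ?thesis unfolding s_def using less_cSUP_iff[OF S(2) bdd[of i]] by blast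
  qed
  then obtain h where h: "\<And>i j. h i j \<in> S" "\<And>i j. P i (h i j) > s i - 1 / real (Suc j)" by metis
  show ?thesis
  proof (rule that[of "\<lambda>n. case prod_decode n of (i, j) \<Rightarrow> h i j"])
    show "(case prod_decode n of (i, j) \<Rightarrow> h i j) \<in> S" for n
      using h(1) by (simp split: prod.split)
    fix f assume f: "f \<in> S"
    have "AE w in M. \<not> (f w \<in> U i \<and> (\<forall>j. h i j w \<notin> U i))" for i
    proof -
      define N where "N = {w \<in> space M. f w \<in> U i} - (\<Union>j. {w \<in> space M. h i j w \<in> U i})"
      have N: "N \<in> sets M"
        unfolding N_def using sets[OF f] sets[OF h(1)] by (intro sets.Diff sets.countable_UN) auto
      have "prob N \<le> 1 / real (Suc j)" for j
      proof -
        \<comment> \<open>Inserting \<open>f\<close> on \<open>N\<close> raises the probability of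
          hitting \<open>U i\<close> by exactly \<open>prob N\<close>. As \<open>h i j\<close> was
          within \<open>1 / Suc j\<close> of the supremum, \<open>prob N\<close> is at most that for
          every \<open>j\<close>.\<close>
        define g where "g = (\<lambda>w. if w \<in> N then f w else h i j w)"
        have g: "g \<in> S" unfolding g_def by (rule decomposableD[OF dec f h(1) N])
        have "{w \<in> space M. g w \<in> U i} = {w \<in> space M. h i j w \<in> U i} \<union> N"
          by (auto simp: g_def N_def)
        moreover have "prob ({w \<in> space M. h i j w \<in> U i} \<union> N) = P i (h i j) + prob N"
          unfolding P_def by (rule finite_measure_Union[OF sets[OF h(1)] N]) (auto simp: N_def)
        ultimately have "P i g = P i (h i j) + prob N" by (simp only: P_def)
        moreover have "P i g \<le> s i" unfolding s_def by (rule cSUP_upper[OF g bdd])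
        ultimately show ?thesis using h(2)[of i j] by linarith
      qed
      moreover have "(\<lambda>j. 1 / real (Suc j)) \<longlonglongrightarrow> 0"
        using LIMSEQ_inverse_real_of_nat by (simp add: inverse_eq_divide)
      ultimately have "prob N \<le> 0" by (intro LIMSEQ_le_const) auto
      then have "prob N = 0" using measure_nonneg[of M N] by linarith
      then have "N \<in> null_sets M" using N by (simp add: null_sets_def emeasure_eq_measure)
      then show ?thesis by (rule AE_I') (auto simp: N_def)
    qed
    then have "AE w in M. \<forall>i. \<not> (f w \<in> U i \<and> (\<forall>j. h i j w \<notin> U i))"
      by (simp add: AE_all_countable)
    then show "AE w in M. f w \<in> closure (range (\<lambda>n. (case prod_decode n of (i, j) \<Rightarrow> h i j) w))"
    proof eventually_elim
      fix w assume *: "\<forall>i. \<not> (f w \<in> U i \<and> (\<forall>j. h i j w \<notin> U i))"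
      show "f w \<in> closure (range (\<lambda>n. (case prod_decode n of (i, j) \<Rightarrow> h i j) w))"
        unfolding closure_iff_nhds_not_empty
      proof (intro allI impI)
        fix A V :: "'e set" assume "V \<subseteq> A" "open V" "f w \<in> V"
        then obtain i where i: "f w \<in> U i" "U i \<subseteq> V" using basis by blast
        then obtain j where j: "h i j w \<in> U i" using * by blast
        have "h i j w \<in> range (\<lambda>n. (case prod_decode n of (i, j) \<Rightarrow> h i j) w)"
          by (rule range_eqI[of _ _ "prod_encode (i, j)"]) simp
        then show "range (\<lambda>n. (case prod_decode n of (i, j) \<Rightarrow> h i j) w) \<inter> A \<noteq> {}"
          using i j \<open>V \<subseteq> A\<close> by blast
      qed
    qed
  qed
qed

text \<open>Glue the first \<open>h k\<close> that comes close to \<open>f w\<close>, for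
  \<open>k < n\<close>, and keep \<open>h 0\<close> where none does. The glued functions lie in
  \<open>S\<close>, and the leftover error vanishes by dominated convergence.\<close>

lemma selection_of_closure_mem:
  fixes S :: "('a \<Rightarrow> 'e::{banach,second_countable_topology}) set"
  assumes dec: "decomposable M S" and cl: "closedin (Lp_top M p) S"
    and h: "\<And>n. h n \<in> S" and f: "f \<in> Lp M p"
    and AE: "AE w in M. f w \<in> closure (range (\<lambda>n::nat. h n w))"
  shows "f \<in> S"
proof (rule closedin_LpD[OF cl f])
  fix e :: real assume e: "e > 0"
  \<comment> \<open>On a probability space, pointwise closeness \<open>d\<close> costs at most
    \<open>d powr p\<close> in the integral; \<open>d < e\<close> leaves
    \<open>e powr p - d powr p\<close> for the leftover.\<close>
  define d where "d = e / 2"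
  have d: "d > 0" using e by (simp add: d_def)
  have hL: "h n \<in> Lp M p" for n using h closedin_Lp_subset[OF cl] by blast
  have [measurable]: "f \<in> borel_measurable M" "\<And>n. h n \<in> borel_measurable M"
    using f hL by (auto intro: Lp_measurable)
  define E where "E n = {w \<in> space M. norm (f w - h n w) < d}" for n
  have [measurable]: "E n \<in> sets M" for n unfolding E_def by measurable
  define g where "g = rec_nat (h 0) (\<lambda>n g w. if w \<in> E n \<and> (\<forall>k<n. w \<notin> E k) then h n w else g w)"
  have g0: "g 0 = h 0" and gS: "g (Suc n) = (\<lambda>w. if w \<in> E n \<and> (\<forall>k<n. w \<notin> E k) then h n w else g n w)" for n
    by (auto simp: g_def fun_eq_iff)
  have gin: "g n \<in> S" for n
  proof (induction n)
    case (Suc n)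
    have "E n - (\<Union>k<n. E k) \<in> sets M" by measurable
    from decomposableD[OF dec h[of n] Suc this] show ?case by (simp add: gS Ball_def)
  qed (simp add: g0 h)
  have gL: "g n \<in> Lp M p" for n using gin closedin_Lp_subset[OF cl] by blast
  have gval: "(if w \<in> (\<Union>k<n. E k) then norm (f w - g n w) < d else g n w = h 0 w)" if "w \<in> space M" for w n
  proof (induction n)
    case (Suc n)
    then show ?case
      by (cases "w \<in> E n") (auto simp: gS less_Suc_eq E_def split: if_splits)
  qed (simp add: g0)
  \<comment> \<open>The error of the default \<open>h 0\<close> on the part not covered so far,
    dominated by the integrable \<open>norm (f - h 0) powr p\<close>.\<close>
  define v where "v n w = (if w \<in> (\<Union>k<n. E k) then 0 else norm ((f - h 0) w) powr p)" for n w
  have vint: "integrable M (\<lambda>w. norm ((f - h 0) w) powr p)" by (intro Lp_integrable Lp_diff f hL)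
  have vm: "v n \<in> borel_measurable M" for n unfolding v_def fun_diff_def by measurable
  have "(\<lambda>n. \<integral>w. v n w \<partial>M) \<longlonglongrightarrow> (\<integral>w. 0 \<partial>M)"
  proof (rule integral_dominated_convergence[OF _ vm vint])
    show "AE w in M. (\<lambda>n. v n w) \<longlonglongrightarrow> 0"
      using AE AE_space
    proof eventually_elim
      fix w assume w: "f w \<in> closure (range (\<lambda>n. h n w))" "w \<in> space M"
      then obtain n where n: "w \<in> E n"
        using d unfolding closure_approachable E_def by (force simp: dist_norm norm_minus_commute)
      have "eventually (\<lambda>k. v k w = 0) sequentially"
        unfolding eventually_sequentially v_def using n by (intro exI[of _ "Suc n"]) auto
      then show "(\<lambda>n. v n w) \<longlonglongrightarrow> 0" by (rule tendsto_eventually)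
    qed
    show "AE w in M. norm (v n w) \<le> norm ((f - h 0) w) powr p" for n by (simp add: v_def)
  qed auto
  then have "(\<lambda>n. \<integral>w. v n w \<partial>M) \<longlonglongrightarrow> 0" by simp
  moreover have "0 < e powr p - d powr p" using e d p_ge_1 by (simp add: d_def powr_less_mono2)
  ultimately have "eventually (\<lambda>n. (\<integral>w. v n w \<partial>M) < e powr p - d powr p) sequentially"
    by (rule order_tendstoD)
  then obtain n where n: "(\<integral>w. v n w \<partial>M) < e powr p - d powr p" by (auto simp: eventually_sequentially)
  have vi: "integrable M (v n)"
    by (rule Bochner_Integration.integrable_bound[OF vint vm]) (simp add: v_def)
  have "(\<integral>w. norm ((f - g n) w) powr p \<partial>M) \<le> (\<integral>w. d powr p + v n w \<partial>M)"
  proof (rule integral_mono)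
    show "integrable M (\<lambda>w. norm ((f - g n) w) powr p)" by (intro Lp_integrable Lp_diff f gL)
    show "integrable M (\<lambda>w. d powr p + v n w)" using vi by simp
    fix w assume "w \<in> space M"
    from gval[OF this, of n] show "norm ((f - g n) w) powr p \<le> d powr p + v n w"
      using p_ge_1 d by (auto simp: v_def intro!: powr_mono2 split: if_splits)
  qed
  also have "\<dots> = d powr p + (\<integral>w. v n w \<partial>M)" using vi by (simp add: prob_space)
  also have "\<dots> < e powr p" using n by simp
  finally show "\<exists>g\<in>S. Lp_norm M p (f - g) < e"
    using gin[of n] e by (intro bexI[of _ "g n"]) (simp_all add: Lp_norm_less_iff)
qed

text \<open>An open set meets the closure iff it meets the range, so the hitting event is a
  countable union of preimages.\<close>

lemma effros_closed_closure_range: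
  fixes h :: "nat \<Rightarrow> 'a \<Rightarrow> 'e::{banach,second_countable_topology}"
  assumes h: "\<And>n. h n \<in> borel_measurable M"
  shows "effros_closed M (\<lambda>w. closure (range (\<lambda>n. h n w)))"
  unfolding effros_closed_def
proof (intro conjI ballI allI impI)
  fix U :: "'e set" assume U: "open U"
  have "{w \<in> space M. closure (range (\<lambda>n. h n w)) \<inter> U \<noteq> {}} = (\<Union>n. h n -` U \<inter> space M)"
    using open_Int_closure_eq_empty[OF U] by (auto simp: Int_commute)
  also have "\<dots> \<in> sets M" using U by (intro sets.countable_UN) (auto intro!: measurable_sets[OF h])
  finally show "{w \<in> space M. closure (range (\<lambda>n. h n w)) \<inter> U \<noteq> {}} \<in> sets M" .
qed simp

text \<open>The Hiai--Umegaki representation: every selection of the closure of the essentially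
  dense sequence returns to \<open>S\<close>, as \<open>S\<close> is closed and
  decomposable.\<close>

lemma decomposable_eq_selections:
  fixes S :: "('a \<Rightarrow> 'e::{banach,second_countable_topology}) set"
  assumes "S \<noteq> {}" and dec: "decomposable M S" and cl: "closedin (Lp_top M p) S"
  obtains X where "effros_closed M X" "S = Lp_sel M p X"
proof -
  note S = closedin_Lp_subset[OF cl]
  obtain h :: "nat \<Rightarrow> 'a \<Rightarrow> 'e" where h: "\<And>n. h n \<in> S"
    "\<And>f. f \<in> S \<Longrightarrow> AE w in M. f w \<in> closure (range (\<lambda>n. h n w))"
    using decomposable_essential_closure[OF S assms(1) dec] by blast
  show ?thesis
  proof (rule that[of "\<lambda>w. closure (range (\<lambda>n. h n w))"])
    show "effros_closed M (\<lambda>w. closure (range (\<lambda>n. h n w)))"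
      using h(1) S by (intro effros_closed_closure_range Lp_measurable) auto
    show "S = Lp_sel M p (\<lambda>w. closure (range (\<lambda>n. h n w)))"
      using h(2) S selection_of_closure_mem[OF dec cl h(1)] by (auto simp: Lp_sel_def)
  qed
qed

text \<open>Existence makes the choice in \<open>F_of\<close> meaningful. These two properties are
  all that is used of the chosen multifunction.\<close>

lemma F_of_props:
  fixes A :: "('a \<Rightarrow> 'e::{banach,second_countable_topology}) set"
  assumes A: "A \<subseteq> Lp M p" "A \<noteq> {}"
  shows "effros_closed M (F_of M p A)" "Lp_sel M p (F_of M p A) = Lp_cl M p (Lp_dec M A)"
proof -
  have "Lp_cl M p (Lp_dec M A) \<noteq> {}" using subset_Lp_cl_dec[OF A(1)] A(2) by blast
  then obtain X where "effros_closed M X" "Lp_cl M p (Lp_dec M A) = Lp_sel M p X"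
    using decomposable_eq_selections[OF _ decomposable_Lp_cl_dec[OF A(1)] closedin_Lp_cl] by blast
  then have "\<exists>X. effros_closed M X \<and> Lp_cl M p (Lp_dec M A) = Lp_sel M p X" by blast
  from someI_ex[OF this]
  show "effros_closed M (F_of M p A)" "Lp_sel M p (F_of M p A) = Lp_cl M p (Lp_dec M A)"
    unfolding F_of_def by auto
qed

section \<open>Castaing representations\<close>

lemma dyadic_steps_converge:
  fixes u :: "nat \<Rightarrow> 'e::banach"
  assumes step: "\<And>k. dist (u k) (u (Suc k)) < r / 2 ^ k" and r: "r > 0"
  shows "convergent u" "dist (u 0) (lim u) \<le> 2 * r"
proof -
  \<comment> \<open>The exact partial geometric sum is carried along, since the bound
    \<open>2 * r / 2 ^ k\<close> alone would not survive the induction on \<open>j\<close>.\<close>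
  have far: "dist (u k) (u (k + j)) \<le> 2 * r / 2 ^ k - 2 * r / 2 ^ (k + j)" for k j
  proof (induction j)
    case (Suc j)
    have "dist (u k) (u (k + Suc j)) \<le> dist (u k) (u (k + j)) + dist (u (k + j)) (u (Suc (k + j)))"
      using dist_triangle[of "u k" "u (k + Suc j)" "u (k + j)"] by simp
    also have "\<dots> \<le> (2 * r / 2 ^ k - 2 * r / 2 ^ (k + j)) + r / 2 ^ (k + j)"
      using Suc step[of "k + j"] by (intro add_mono) auto
    also have "\<dots> = 2 * r / 2 ^ k - 2 * r / 2 ^ (k + Suc j)" by (simp add: field_simps)
    finally show ?case .
  qed simp
  have far': "dist (u k) (u (k + j)) \<le> 2 * r / 2 ^ k" for k j
    using far[of k j] r by (smt (verit) divide_nonneg_nonneg zero_le_power)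
  have "Cauchy u"
    unfolding Cauchy_altdef2
  proof (intro allI impI)
    fix e :: real assume e: "e > 0"
    have "(\<lambda>k. 2 * r * (1 / 2) ^ k) \<longlonglongrightarrow> 2 * r * 0"
      by (intro tendsto_mult tendsto_const LIMSEQ_realpow_zero) auto
    then have "eventually (\<lambda>k. 2 * r * (1 / 2) ^ k < e) sequentially"
      using e by (intro order_tendstoD(2)[of _ "2 * r * 0"]) auto
    then obtain k where k: "2 * r * (1 / 2) ^ k < e" by (auto simp: eventually_sequentially)
    have "2 * r / 2 ^ k < e" using k by (simp add: power_divide)
    then have "dist (u n) (u k) < e" if "n \<ge> k" for n
      using far'[of k "n - k"] that dist_commute[of "u n" "u k"] by simp
    then show "\<exists>N. \<forall>n\<ge>N. dist (u n) (u N) < e" by blast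
  qed
  then show c: "convergent u" by (simp add: Cauchy_convergent)
  have "(\<lambda>n. dist (u 0) (u n)) \<longlonglongrightarrow> dist (u 0) (lim u)"
    using c by (intro tendsto_dist tendsto_const) (simp add: convergent_LIMSEQ_iff)
  then show "dist (u 0) (lim u) \<le> 2 * r"
    by (rule LIMSEQ_le_const2) (use far'[of 0] in auto)
qed

text \<open>The Kuratowski--Ryll-Nardzewski construction, started at the centre of a given ball.\<close>

lemma selection_near_point:
  fixes X :: "'a \<Rightarrow> 'e::{banach,second_countable_topology} set"
  assumes X: "effros_closed M X" and f: "f \<in> Lp_sel M p X" and r: "r > 0"
  obtains g where "g \<in> Lp_sel M p X"
    "\<And>w. w \<in> space M \<Longrightarrow> X w \<inter> ball c r \<noteq> {} \<Longrightarrow> dist c (g w) \<le> 4 * r"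
proof -
  obtain d :: "nat \<Rightarrow> 'e" where d: "\<And>y e. e > 0 \<Longrightarrow> \<exists>n. dist (d n) y < e"
    using separable_dense_sequence by blast
  have closed: "closed (X w)" if "w \<in> space M" for w using X that by (simp add: effros_closed_def)
  have hit: "{w \<in> space M. X w \<inter> U \<noteq> {}} \<in> sets M" if "open U" for U
    using X that by (simp add: effros_closed_def)
  \<comment> \<open>The centre \<open>c\<close> is put in front of the dense sequence, so the
    initial index 0 starts every approximation at \<open>c\<close>.\<close>
  define x where "x = case_nat c d"
  define A where "A = {w \<in> space M. X w \<inter> ball c r \<noteq> {}}"
  have A: "A \<in> sets M" unfolding A_def by (rule hit) simp
  \<comment> \<open>A common point of \<open>X w\<close> with both balls keeps the next centre near
    the present one and near \<open>X w\<close>. The intersection is open, so Effros measurability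
    makes each \<open>Q k i j\<close> an event.\<close>
  define Q where "Q k i j w \<longleftrightarrow> X w \<inter> (ball (x j) (r / 2 ^ Suc k) \<inter> ball (x i) (r / 2 ^ k)) \<noteq> {}" for k i j w
  define n where "n = (\<lambda>w. rec_nat (0::nat) (\<lambda>k i. LEAST j. Q k i j w))"
  have n0: "n w 0 = 0" and nS: "n w (Suc k) = (LEAST j. Q k (n w k) j w)" for w k
    by (simp_all add: n_def)
  have Qm: "Measurable.pred M (Q k i j)" for k i j
    unfolding pred_def Q_def by (intro hit open_Int open_ball)
  have nm: "(\<lambda>w. n w k) \<in> measurable M (count_space UNIV)" for k
  proof (induction k)
    case (Suc k)
    have "Measurable.pred M (\<lambda>w. Q k (n w k) j w)" for j
      by (rule measurable_compose_countable[OF Qm Suc])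
    then show ?case unfolding nS by (intro measurable_Least)
  qed (simp add: n0)
  have inv: "X w \<inter> ball (x (n w k)) (r / 2 ^ k) \<noteq> {}" and Qn: "Q k (n w k) (n w (Suc k)) w"
    if w: "w \<in> A" for w k
  proof -
    have Qex: "Q k i (LEAST j. Q k i j w) w" if ne: "X w \<inter> ball (x i) (r / 2 ^ k) \<noteq> {}" for k i
    proof -
      obtain y where y: "y \<in> X w" "y \<in> ball (x i) (r / 2 ^ k)" using ne by blast
      obtain j where "dist (d j) y < r / 2 ^ Suc k" using d[of "r / 2 ^ Suc k" y] r by auto
      then have "Q k i (Suc j) w" using y by (auto simp: Q_def x_def)
      then show ?thesis by (rule LeastI)
    qed
    show *: "X w \<inter> ball (x (n w k)) (r / 2 ^ k) \<noteq> {}" for k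
    proof (induction k)
      case 0
      then show ?case using w by (simp add: n0 A_def x_def)
    next
      case (Suc k)
      from Qex[OF this] show ?case unfolding nS Q_def by blast
    qed
    show "Q k (n w k) (n w (Suc k)) w" unfolding nS by (rule Qex[OF *])
  qed
  \<comment> \<open>Successive balls share a point, so the sum of their radii bounds the step. The
    steps start at \<open>2 * r\<close>, which gives the total distance
    \<open>4 * r\<close>.\<close>
  have step: "dist (x (n w k)) (x (n w (Suc k))) < 2 * r / 2 ^ k" if w: "w \<in> A" for w k
  proof -
    obtain y where y: "dist (x (n w (Suc k))) y < r / 2 ^ Suc k" "dist (x (n w k)) y < r / 2 ^ k"
      using Qn[OF w, of k] by (auto simp: Q_def)
    have "r / 2 ^ Suc k \<le> r / 2 ^ k" using r by (intro divide_left_mono) auto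
    then show ?thesis using y dist_triangle2[of "x (n w k)" "x (n w (Suc k))" y] by simp
  qed
  \<comment> \<open>Where \<open>X w\<close> misses the ball the given selection \<open>f\<close> is
    used. This keeps the limit a selection, and p-integrable, being bounded on
    \<open>A\<close>.\<close>
  define G where "G k w = (if w \<in> A then x (n w k) else f w)" for k w
  have fm: "f \<in> borel_measurable M" using f by (auto simp: Lp_sel_def intro: Lp_measurable)
  have Gm: "G k \<in> borel_measurable M" for k
    unfolding G_def using A fm measurable_compose[OF nm, of x borel] by (intro measurable_If_set) auto
  define g where "g w = lim (\<lambda>k. G k w)" for w
  have gm: "g \<in> borel_measurable M" unfolding g_def by (rule borel_measurable_lim_metric[OF Gm])
  have goff: "g w = f w" if "w \<notin> A" for w using that by (simp add: g_def G_def)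
  have gon: "dist c (g w) \<le> 4 * r \<and> g w \<in> X w" if w: "w \<in> A" for w
  proof -
    have G: "G k w = x (n w k)" for k using w by (simp add: G_def)
    have c: "convergent (\<lambda>k. G k w)" "dist (G 0 w) (lim (\<lambda>k. G k w)) \<le> 2 * (2 * r)"
      using dyadic_steps_converge[of "\<lambda>k. G k w" "2 * r"] step[OF w] r unfolding G by auto
    have Glim: "(\<lambda>k. G k w) \<longlonglongrightarrow> g w" unfolding g_def using c(1) by (simp add: convergent_LIMSEQ_iff)
    have "\<exists>y. y \<in> X w \<and> dist (G k w) y < r / 2 ^ k" for k using inv[OF w, of k] by (auto simp: G)
    then obtain y where y: "\<And>k. y k \<in> X w" "\<And>k. dist (G k w) (y k) < r / 2 ^ k" by metis
    have "(\<lambda>k. r * (1 / 2) ^ k) \<longlonglongrightarrow> r * 0"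
      by (intro tendsto_mult tendsto_const LIMSEQ_realpow_zero) auto
    then have "(\<lambda>k. r / 2 ^ k) \<longlonglongrightarrow> 0" by (simp add: power_divide)
    then have "(\<lambda>k. dist (G k w) (y k)) \<longlonglongrightarrow> 0"
      by (rule tendsto_sandwich[OF _ _ tendsto_const, rotated 2]) (auto intro!: always_eventually less_imp_le y(2))
    then have "(\<lambda>k. G k w - (G k w - y k)) \<longlonglongrightarrow> g w - 0"
      unfolding dist_norm by (rule tendsto_diff[OF Glim tendsto_norm_zero_cancel])
    then have "y \<longlonglongrightarrow> g w" by simp
    then have "g w \<in> X w" using closed_sequentially[OF closed y(1)] w by (auto simp: A_def)
    moreover have "G 0 w = c" by (simp add: G n0 x_def)
    ultimately show ?thesis using c(2) by (simp add: g_def)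
  qed
  have "g \<in> Lp M p"
  proof (rule Lp_bound[OF gm])
    show "integrable M (\<lambda>w. (norm c + 4 * r) powr p + norm (f w) powr p)"
      using f by (auto simp: Lp_sel_def intro!: Lp_integrable)
    have "norm (g w) powr p \<le> (norm c + 4 * r) powr p + norm (f w) powr p" for w
    proof (cases "w \<in> A")
      case True
      have "norm (g w) \<le> norm c + dist c (g w)" using norm_triangle_sub[of "g w" c] by (simp add: dist_norm norm_minus_commute)
      then have "norm (g w) powr p \<le> (norm c + 4 * r) powr p"
        using gon[OF True] p_ge_1 by (intro powr_mono2) auto
      then show ?thesis by (simp add: add_increasing2)
    qed (simp add: goff)
    then show "AE w in M. norm (g w) powr p \<le> (norm c + 4 * r) powr p + norm (f w) powr p" by simp
  qed
  moreover have "AE w in M. f w \<in> X w" using f by (simp add: Lp_sel_def)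
  then have "AE w in M. g w \<in> X w"
    by eventually_elim (use gon goff in metis)
  ultimately have "g \<in> Lp_sel M p X" by (simp add: Lp_sel_def)
  then show ?thesis using that gon by (auto simp: A_def)
qed

text \<open>One selection is taken for each ball of radius \<open>1 / Suc j\<close> about each point
  of a dense sequence. A point of \<open>X w\<close> lies in such balls of arbitrarily small radius,
  and the selection stays within four radii of the centre.\<close>

lemma castaing_representation:
  fixes X :: "'a \<Rightarrow> 'e::{banach,second_countable_topology} set"
  assumes X: "effros_closed M X" and ne: "Lp_sel M p X \<noteq> {}"
  obtains g :: "nat \<Rightarrow> 'a \<Rightarrow> 'e" where "\<And>n. g n \<in> Lp_sel M p X"
    "AE w in M. X w = closure (range (\<lambda>n. g n w))"
proof -
  obtain f where f: "f \<in> Lp_sel M p X" using ne by blast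
  obtain d :: "nat \<Rightarrow> 'e" where d: "\<And>y e. e > 0 \<Longrightarrow> \<exists>n. dist (d n) y < e"
    using separable_dense_sequence by blast
  have "\<exists>g. g \<in> Lp_sel M p X \<and>
      (\<forall>w\<in>space M. X w \<inter> ball (d i) (1 / real (Suc j)) \<noteq> {} \<longrightarrow> dist (d i) (g w) \<le> 4 * (1 / real (Suc j)))" for i j
    using selection_near_point[OF X f, of "1 / real (Suc j)" "d i"] by (metis of_nat_0_less_iff zero_less_Suc zero_less_divide_1_iff)
  then obtain h where h: "\<And>i j. h i j \<in> Lp_sel M p X"
      "\<And>i j w. w \<in> space M \<Longrightarrow> X w \<inter> ball (d i) (1 / real (Suc j)) \<noteq> {} \<Longrightarrow> dist (d i) (h i j w) \<le> 4 * (1 / real (Suc j))"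
    by metis
  define g where "g n = (case prod_decode n of (i, j) \<Rightarrow> h i j)" for n
  have g: "g n \<in> Lp_sel M p X" for n using h(1) by (simp add: g_def split: prod.split)
  then have "AE w in M. \<forall>n. g n w \<in> X w" by (simp add: Lp_sel_def AE_all_countable)
  then have "AE w in M. X w = closure (range (\<lambda>n. g n w))"
    using AE_space
  proof eventually_elim
    fix w assume gX: "\<forall>n. g n w \<in> X w" and w: "w \<in> space M"
    have "closed (X w)" using X w by (simp add: effros_closed_def)
    then have "closure (range (\<lambda>n. g n w)) \<subseteq> X w" using gX by (intro closure_minimal) auto
    moreover have "y \<in> closure (range (\<lambda>n. g n w))" if y: "y \<in> X w" for y
      unfolding closure_approachable
    proof (intro allI impI)
      fix e :: real assume e: "e > 0"
      \<comment> \<open>Five radii: four from the selection to the centre \<open>d i\<close>, one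
        from the centre to \<open>y\<close>.\<close>
      then obtain j where j: "1 / real (Suc j) < e / 5"
        using reals_Archimedean[of "e / 5"] by (auto simp: inverse_eq_divide)
      obtain i where i: "dist (d i) y < 1 / real (Suc j)" using d[of "1 / real (Suc j)" y] by auto
      then have "dist (d i) (h i j w) \<le> 4 * (1 / real (Suc j))" using h(2)[OF w] y by (auto simp: disjoint_iff)
      then have "dist (h i j w) y < e" using i j dist_triangle3[of "h i j w" y "d i"] by linarith
      moreover have "h i j w = g (prod_encode (i, j)) w" by (simp add: g_def)
      ultimately show "\<exists>z\<in>range (\<lambda>n. g n w). dist z y < e" by auto
    qed
    ultimately show "X w = closure (range (\<lambda>n. g n w))" by blast
  qed
  with g show ?thesis by (rule that)
qed

text \<open>A Castaing representation of \<open>X\<close> consists of countably many selections, so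
  their a.s. memberships in \<open>Y\<close> share one null set; closedness of \<open>Y w\<close>
  does the rest.\<close>

lemma selections_subset_imp_subset:
  fixes X Y :: "'a \<Rightarrow> 'e::{banach,second_countable_topology} set"
  assumes X: "effros_closed M X" "Lp_sel M p X \<noteq> {}" and sub: "Lp_sel M p X \<subseteq> Lp_sel M p Y"
    and Y: "AE w in M. closed (Y w)"
  shows "AE w in M. X w \<subseteq> Y w"
proof -
  obtain g :: "nat \<Rightarrow> 'a \<Rightarrow> 'e" where g: "\<And>n. g n \<in> Lp_sel M p X" "AE w in M. X w = closure (range (\<lambda>n. g n w))"
    using castaing_representation[OF X] by blast
  have "AE w in M. \<forall>n. g n w \<in> Y w"
    using g(1) sub by (auto simp: Lp_sel_def AE_all_countable)
  then show ?thesis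
    using g(2) Y
  proof eventually_elim
    fix w assume "\<forall>n. g n w \<in> Y w" "X w = closure (range (\<lambda>n. g n w))" "closed (Y w)"
    then show "X w \<subseteq> Y w" using closure_minimal[of "range (\<lambda>n. g n w)" "Y w"] by auto
  qed
qed

text \<open>Rational weights and a countable dense family of selections leave one null set.
  Continuity of the convex combination then reaches all weights and all points of the closed set
  \<open>X w\<close>.\<close>

lemma convex_selections_imp_convex:
  fixes X :: "'a \<Rightarrow> 'e::{banach,second_countable_topology} set"
  assumes X: "effros_closed M X" "Lp_sel M p X \<noteq> {}" and cvx: "convex (Lp_sel M p X)"
  shows "AE w in M. convex (X w)"
proof -
  obtain g :: "nat \<Rightarrow> 'a \<Rightarrow> 'e" where g: "\<And>n. g n \<in> Lp_sel M p X" "AE w in M. X w = closure (range (\<lambda>n. g n w))"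
    using castaing_representation[OF X] by blast
  define T where "T = \<rat> \<inter> {0..1::real}"
  have T: "countable T" unfolding T_def using countable_rat by blast
  have "u *\<^sub>R g m + (1 - u) *\<^sub>R g n \<in> Lp_sel M p X" if "u \<in> T" for u m n
    using that g(1) by (intro convexD[OF cvx]) (auto simp: T_def)
  then have "AE w in M. u *\<^sub>R g m w + (1 - u) *\<^sub>R g n w \<in> X w" if "u \<in> T" for u m n
    using that by (fastforce simp: Lp_sel_def)
  then have "AE w in M. \<forall>u\<in>T. \<forall>m n. u *\<^sub>R g m w + (1 - u) *\<^sub>R g n w \<in> X w"
    by (simp add: AE_ball_countable[OF T] AE_all_countable)
  then show ?thesis
    using g(2)
  proof eventually_elim
    fix w assume *: "\<forall>u\<in>T. \<forall>m n. u *\<^sub>R g m w + (1 - u) *\<^sub>R g n w \<in> X w"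
      and Xw: "X w = closure (range (\<lambda>n. g n w))"
    define R where "R = range (\<lambda>n. g n w)"
    define F where "F = (\<lambda>(u::real, a, b). u *\<^sub>R a + (1 - u) *\<^sub>R (b::'e))"
    have cont: "continuous_on (closure (T \<times> R \<times> R)) F"
      unfolding F_def case_prod_beta by (intro continuous_intros)
    have "F ` (T \<times> R \<times> R) \<subseteq> X w" using * by (auto simp: F_def R_def)
    moreover have "closed (X w)" by (simp add: Xw)
    ultimately have "F ` closure (T \<times> R \<times> R) \<subseteq> X w"
      using image_closure_subset[OF cont] by blast
    then have F: "F ` (closure T \<times> X w \<times> X w) \<subseteq> X w" by (simp add: closure_Times Xw R_def)
    \<comment> \<open>Rationals approach \<open>t\<close> from the right without leaving the unit
      interval, hence the separate case \<open>t = 1\<close>.\<close>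
    have clT: "{0..1} \<subseteq> closure T"
    proof
      fix t :: real assume t: "t \<in> {0..1}"
      show "t \<in> closure T"
      proof (cases "t = 1")
        case True
        then have "t \<in> T" by (simp add: T_def)
        then show ?thesis using closure_subset by blast
      next
        case False
        show ?thesis
          unfolding closure_approachable
        proof (intro allI impI)
          fix e :: real assume "e > 0"
          then have "t < min 1 (t + e)" using t False by auto
          then obtain s where "s \<in> \<rat>" "t < s" "s < min 1 (t + e)" using Rats_dense_in_real by blast
          then show "\<exists>s\<in>T. dist s t < e" using t by (intro bexI[of _ s]) (auto simp: T_def dist_real_def)
        qed
      qed
    qed
    show "convex (X w)"
    proof (rule convexI)
      fix a b and u v :: real assume ab: "a \<in> X w" "b \<in> X w" and uv: "0 \<le> u" "0 \<le> v" "u + v = 1"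
      then have "u \<in> closure T" "v = 1 - u" using clT by auto
      then have "F (u, a, b) \<in> X w" using F ab by blast
      then show "u *\<^sub>R a + v *\<^sub>R b \<in> X w" by (simp add: F_def \<open>v = 1 - u\<close>)
    qed
  qed
qed


section \<open>Dirac kernels and the p-Choquet decomposable hull\<close>

lemma regular_borel_return: "regular_borel_E (return borel (x :: 'e::{banach,second_countable_topology}))"
  unfolding regular_borel_E_def
proof
  fix B :: "'e set" assume B: "B \<in> sets borel"
  let ?N = "return borel x" and ?C = "{C. compact C \<and> C \<subseteq> B}"
  have "emeasure ?N B \<le> (SUP C\<in>?C. emeasure ?N C)"
  proof (cases "x \<in> B")
    case True
    then have "emeasure ?N {x} \<le> (SUP C\<in>?C. emeasure ?N C)" by (intro SUP_upper) auto
    then show ?thesis using True B by simp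
  qed (use B in simp)
  moreover have "(SUP C\<in>?C. emeasure ?N C) \<le> emeasure ?N B"
    using B by (intro SUP_least emeasure_mono) auto
  ultimately show "emeasure ?N B = (SUP C\<in>?C. emeasure ?N C)" by (rule antisym)
qed

lemma integrable_return:
  fixes g :: "'b \<Rightarrow> 'f::{banach,second_countable_topology}"
  assumes "x \<in> space N" "g \<in> borel_measurable N"
  shows "integrable (return N x) g"
proof -
  interpret R: prob_space "return N x" by (rule prob_space_return[OF assms(1)])
  have "AE y in return N x. norm (g y) \<le> norm (g x)"
    using assms by (subst AE_return) auto
  then show ?thesis using assms(2) by (intro R.integrable_const_bound) auto
qed

lemma selections_subset_p_choquet_dec:
  fixes B :: "('a \<Rightarrow> 'e::{banach,second_countable_topology}) set"
  assumes B: "B \<subseteq> Lp M p" "B \<noteq> {}" and cd: "p_choquet_dec M p B"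
  shows "Lp_sel M p (F_of M p B) \<subseteq> B"
proof
  fix f assume f: "f \<in> Lp_sel M p (F_of M p B)"
  \<comment> \<open>The Dirac kernel along \<open>f\<close> has barycenter \<open>f\<close>, so
    Choquet decomposability applied to it yields exactly \<open>f \<in> B\<close>.\<close>
  define K where "K = (\<lambda>w. return (borel :: 'e measure) (f w))"
  have fL: "f \<in> Lp M p" using f by (simp add: Lp_sel_def)
  have fm: "f \<in> borel_measurable M" by (rule Lp_measurable[OF fL])
  have "trans_kernel M K"
    unfolding trans_kernel_def K_def using fm
    by (auto simp: regular_borel_return intro!: prob_space_return measurable_compose[OF fm])
  moreover have "AE w in M. emeasure (K w) (F_of M p B w) = 1"
  proof -
    have "AE w in M. f w \<in> F_of M p B w" using f by (simp add: Lp_sel_def)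
    then show ?thesis
      using AE_space
    proof eventually_elim
      fix w assume w: "f w \<in> F_of M p B w" "w \<in> space M"
      then have "closed (F_of M p B w)" using F_of_props(1)[OF B] by (simp add: effros_closed_def)
      then show "emeasure (K w) (F_of M p B w) = 1" using w by (simp add: K_def)
    qed
  qed
  moreover have bary: "kernel_bary M K f"
    unfolding kernel_bary_def K_def
  proof (intro conjI fm allI impI AE_I2)
    fix L :: "'e \<Rightarrow> real" and w assume L: "bounded_linear L"
    have "L \<in> borel_measurable borel"
      using L by (intro borel_measurable_continuous_onI linear_continuous_on) simp
    then show "integrable (return borel (f w)) L" "L (f w) = (\<integral>x. L x \<partial>return borel (f w))"
      by (auto intro: integrable_return simp: integral_return)
  qed
  moreover have "AE w in M. \<exists>x. K w = return borel x" by (auto simp: K_def)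
  ultimately have "K \<in> Kdelta M p B" using fL by (auto simp: Kdelta_def)
  then show "f \<in> B" using cd fL bary by (auto simp: p_choquet_dec_def)
qed

text \<open>The null set in \<open>kernel_bary\<close> depends on the functional. A separating
  sequence leaves one null set, off which the Dirac point of \<open>K w\<close> must be
  \<open>Y w\<close>.\<close>

lemma p_choquet_dec_if_selections_subset:
  fixes B :: "('a \<Rightarrow> 'e::{banach,second_countable_topology}) set"
  assumes B: "B \<subseteq> Lp M p" "B \<noteq> {}" and sub: "Lp_sel M p (F_of M p B) \<subseteq> B"
  shows "p_choquet_dec M p B"
  unfolding p_choquet_dec_def
proof (intro ballI impI)
  fix K Y assume K: "K \<in> Kdelta M p B" and Y: "Y \<in> Lp M p" and bary: "kernel_bary M K Y"
  obtain L :: "nat \<Rightarrow> 'e \<Rightarrow> real" where L: "\<And>n. bounded_linear (L n)" "\<And>x. (\<And>n. L n x = 0) \<Longrightarrow> x = 0"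
    using separating_functionals by blast
  have Lm: "L n \<in> borel_measurable borel" for n
    using L(1) by (intro borel_measurable_continuous_onI linear_continuous_on) simp
  have "AE w in M. emeasure (K w) (F_of M p B w) = 1" "AE w in M. \<exists>x. K w = return borel x"
    using K by (auto simp: Kdelta_def)
  moreover have "AE w in M. \<forall>n. L n (Y w) = (\<integral>x. L n x \<partial>K w)"
    using bary L(1) by (auto simp: kernel_bary_def AE_all_countable elim!: allE impE)
  ultimately have "AE w in M. Y w \<in> F_of M p B w"
    using AE_space
  proof eventually_elim
    fix w assume e: "emeasure (K w) (F_of M p B w) = 1" and "\<exists>x. K w = return borel x"
      and l: "\<forall>n. L n (Y w) = (\<integral>x. L n x \<partial>K w)" and w: "w \<in> space M"
    then obtain x where x: "K w = return borel x" by blast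
    have "L n (Y w - x) = 0" for n
      using l Lm[of n] linear_diff[OF bounded_linear.linear[OF L(1)]] by (simp add: x integral_return)
    then have "Y w = x" using L(2)[of "Y w - x"] by simp
    \<comment> \<open>Closedness makes the value a Borel set, so its Dirac mass is an indicator, and
      mass 1 means membership.\<close>
    moreover have "closed (F_of M p B w)" using F_of_props(1)[OF B] w by (simp add: effros_closed_def)
    then have "x \<in> F_of M p B w" using e by (simp add: x indicator_def split: if_splits)
    ultimately show "Y w \<in> F_of M p B w" by simp
  qed
  then show "Y \<in> B" using Y sub by (auto simp: Lp_sel_def)
qed

text \<open>The set \<open>?Q\<close> equals its own closed decomposable hull, hence contains all
  selections of its multifunction. Conversely a competitor \<open>B\<close> contains the selections
  of its own multifunction, that is \<open>cl dec B\<close>, which contains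
  \<open>cl dec A\<close>.\<close>

lemma chd_eq_Lp_cl_dec:
  fixes A :: "('a \<Rightarrow> 'e::{banach,second_countable_topology}) set"
  assumes A: "A \<subseteq> Lp M p" "A \<noteq> {}"
  shows "chd M p A = Lp_cl M p (Lp_dec M A)"
proof (rule antisym)
  let ?Q = "Lp_cl M p (Lp_dec M A)"
  have Q: "decomposable M ?Q" "closedin (Lp_top M p) ?Q"
    using decomposable_Lp_cl_dec[OF A(1)] closedin_Lp_cl by auto
  have AQ: "A \<subseteq> ?Q" by (rule subset_Lp_cl_dec[OF A(1)])
  have QL: "?Q \<subseteq> Lp M p" by (rule closedin_Lp_subset[OF Q(2)])
  have ne: "?Q \<noteq> {}" using AQ A(2) by blast
  have "p_choquet_dec M p ?Q"
    using p_choquet_dec_if_selections_subset[OF QL ne] F_of_props(2)[OF QL ne] Lp_cl_dec_eq[OF Q] by simp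
  then show "chd M p A \<subseteq> ?Q"
    unfolding chd_def using AQ closedin_Lp_sets[OF Q(2)] by (intro Inter_lower) simp
  show "?Q \<subseteq> chd M p A"
    unfolding chd_def
  proof (rule Inter_greatest)
    fix B assume "B \<in> {B \<in> Lp_sets M p. A \<subseteq> B \<and> p_choquet_dec M p B}"
    then have B: "B \<subseteq> Lp M p" "A \<subseteq> B" "p_choquet_dec M p B" by (auto simp: Lp_sets_def)
    have neB: "B \<noteq> {}" using A(2) B(2) by blast
    have "Lp_dec M A \<subseteq> Lp_dec M B"
      unfolding subset_iff Lp_dec_iff_index using B(2) by blast
    then have "?Q \<subseteq> Lp_cl M p (Lp_dec M B)" by (rule Lp_cl_mono)
    also have "\<dots> \<subseteq> B"
      using selections_subset_p_choquet_dec[OF B(1) neB B(3)] F_of_props(2)[OF B(1) neB] by simp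
    finally show "?Q \<subseteq> B" .
  qed
qed

section \<open>Closed convex sets are Choquet sets\<close>

text \<open>The gap \<open>\<delta>\<close> is the distance from \<open>y\<close> to
  \<open>S\<close>, positive because \<open>S\<close> is closed.\<close>

lemma Lp_separation:
  fixes S :: "('a \<Rightarrow> 'e::{banach,second_countable_topology}) set"
  assumes cl: "closedin (Lp_top M p) S" and cvx: "convex S" and ne: "S \<noteq> {}"
    and y: "y \<in> Lp M p" "y \<notin> S"
  obtains l \<delta> where "l \<in> Lp_dual M p" "\<delta> > 0" "\<And>f. f \<in> S \<Longrightarrow> l f \<le> l y - \<delta>"
proof -
  note S = closedin_Lp_subset[OF cl]
  obtain \<pi> :: "('a \<Rightarrow> 'e) \<Rightarrow> ('a \<Rightarrow> 'e)" where \<pi>: "range \<pi> \<subseteq> Lp M p" "linear \<pi>" "\<And>f. f \<in> Lp M p \<Longrightarrow> \<pi> f = f"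
    using linear_exists_left_inverse_on[OF linear_id subspace_Lp] by auto
  have \<pi>L: "\<pi> f \<in> Lp M p" for f using \<pi>(1) by blast
  \<comment> \<open>A subgradient at \<open>y\<close> of the distance to \<open>S\<close> separates; the projection \<open>\<pi>\<close> makes the distance finite on all functions.\<close>
  define \<phi> where "\<phi> f = (INF d\<in>S. Lp_norm M p (\<pi> f - d))" for f
  have bdd: "bdd_below ((\<lambda>d. Lp_norm M p (\<pi> f - d)) ` S)" for f
    by (rule bdd_belowI2[where m=0]) simp
  have le: "\<phi> f \<le> Lp_norm M p (\<pi> f - d)" if "d \<in> S" for f d
    unfolding \<phi>_def by (rule cINF_lower[OF bdd that])
  have "convex_on UNIV \<phi>"
    unfolding convex_on_def
  proof (intro conjI ballI allI impI)
    fix f g :: "'a \<Rightarrow> 'e" and u v :: real assume uv: "0 \<le> u" "0 \<le> v" "u + v = 1"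
    show "\<phi> (u *\<^sub>R f + v *\<^sub>R g) \<le> u * \<phi> f + v * \<phi> g"
    proof (rule field_le_epsilon)
      fix e :: real assume "e > 0"
      then have "\<phi> f < \<phi> f + e" "\<phi> g < \<phi> g + e" by auto
      then obtain a b where ab: "a \<in> S" "Lp_norm M p (\<pi> f - a) < \<phi> f + e" "b \<in> S" "Lp_norm M p (\<pi> g - b) < \<phi> g + e"
        unfolding \<phi>_def using cINF_less_iff[OF ne bdd] by metis
      have d: "\<pi> f - a \<in> Lp M p" "\<pi> g - b \<in> Lp M p" using \<pi>L ab S by (auto intro: Lp_diff)
      have "u *\<^sub>R a + v *\<^sub>R b \<in> S" using ab uv by (intro convexD[OF cvx])
      then have "\<phi> (u *\<^sub>R f + v *\<^sub>R g) \<le> Lp_norm M p (\<pi> (u *\<^sub>R f + v *\<^sub>R g) - (u *\<^sub>R a + v *\<^sub>R b))" by (rule le)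
      also have "\<pi> (u *\<^sub>R f + v *\<^sub>R g) - (u *\<^sub>R a + v *\<^sub>R b) = u *\<^sub>R (\<pi> f - a) + v *\<^sub>R (\<pi> g - b)"
        by (simp add: linear_add[OF \<pi>(2)] linear_scale[OF \<pi>(2)] algebra_simps)
      also have "Lp_norm M p \<dots> \<le> u * Lp_norm M p (\<pi> f - a) + v * Lp_norm M p (\<pi> g - b)"
        using Lp_norm_triangle[OF Lp_scaleR[OF d(1), of u] Lp_scaleR[OF d(2), of v]] uv
        by (simp add: Lp_norm_scaleR)
      also have "\<dots> \<le> u * (\<phi> f + e) + v * (\<phi> g + e)"
        using ab uv by (intro add_mono mult_left_mono) auto
      also have "\<dots> = u * \<phi> f + v * \<phi> g + (u + v) * e" by (simp add: algebra_simps)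
      also have "\<dots> = u * \<phi> f + v * \<phi> g + e" by (simp only: uv(3) mult_1)
      finally show "\<phi> (u *\<^sub>R f + v *\<^sub>R g) \<le> u * \<phi> f + v * \<phi> g + e" .
    qed
  qed simp
  then obtain l where l: "linear l" "\<And>h. l h \<le> \<phi> (y + h) - \<phi> y"
    by (rule convex_subgradient[where y=y]) blast
  \<comment> \<open>The distance function grows at most by the norm of the increment, so its
    subgradient is bounded with constant 1.\<close>
  have lN: "l h \<le> Lp_norm M p h" if h: "h \<in> Lp M p" for h
  proof -
    have "\<phi> (y + h) - Lp_norm M p h \<le> Lp_norm M p (\<pi> y - d)" if d: "d \<in> S" for d
    proof -
      have dL: "y - d \<in> Lp M p" using d S y by (auto intro: Lp_diff)
      have "\<phi> (y + h) \<le> Lp_norm M p (\<pi> (y + h) - d)" by (rule le[OF d])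
      also have "\<pi> (y + h) - d = (y - d) + h" using \<pi>(3)[OF Lp_add[OF y(1) h]] by simp
      also have "Lp_norm M p \<dots> \<le> Lp_norm M p (y - d) + Lp_norm M p h" by (rule Lp_norm_triangle[OF dL h])
      finally show ?thesis unfolding \<pi>(3)[OF y(1)] by linarith
    qed
    then have "\<phi> (y + h) - Lp_norm M p h \<le> \<phi> y" unfolding \<phi>_def[of y] by (rule cINF_greatest[OF ne])
    then show ?thesis using l(2)[of h] by simp
  qed
  have "\<bar>l h\<bar> \<le> 1 * Lp_norm M p h" if h: "h \<in> Lp M p" for h
    using lN[OF h] lN[OF Lp_scaleR[OF h, of "-1"]] linear_neg[OF l(1), of h] Lp_norm_scaleR[of "-1" h] by simp
  moreover have "l (\<lambda>w. a *\<^sub>R f w + b *\<^sub>R g w) = a * l f + b * l g" for a b f g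
  proof -
    have "(\<lambda>w. a *\<^sub>R f w + b *\<^sub>R g w) = a *\<^sub>R f + b *\<^sub>R g" by (simp add: fun_eq_iff)
    then show ?thesis by (simp only: linear_add[OF l(1)] linear_scale[OF l(1)] real_scaleR_def)
  qed
  ultimately have dual: "l \<in> Lp_dual M p" unfolding Lp_dual_def by blast
  have pos: "\<phi> y > 0"
  proof (rule ccontr)
    assume "\<not> \<phi> y > 0"
    then have "\<exists>d\<in>S. Lp_norm M p (y - d) < e" if "e > 0" for e
      using cINF_less_iff[OF ne bdd[of y], of e] that \<pi>(3)[OF y(1)] by (simp add: \<phi>_def)
    then have "y \<in> S" by (rule closedin_LpD[OF cl y(1)])
    then show False using y(2) by blast
  qed
  have "l f \<le> l y - \<phi> y" if f: "f \<in> S" for f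
  proof -
    have "\<phi> f \<le> 0" using le[OF f, of f] \<pi>(3)[of f] f S by auto
    moreover have "l (f - y) \<le> \<phi> f - \<phi> y" using l(2)[of "f - y"] by simp
    ultimately show ?thesis using linear_diff[OF l(1), of f y] by simp
  qed
  then show ?thesis using that dual pos by blast
qed

text \<open>If \<open>y\<close> were outside \<open>S\<close>, a separating functional would stay
  below \<open>l y - \<delta>\<close> almost everywhere for the measure, and its integral could not
  equal \<open>l y\<close>.\<close>

lemma choquet_set_closed_convex:
  fixes S :: "('a \<Rightarrow> 'e::{banach,second_countable_topology}) set"
  assumes cl: "closedin (Lp_top M p) S" and cvx: "convex S" and ne: "S \<noteq> {}"
  shows "choquet_set M p S"
  unfolding choquet_set_def
proof (intro ballI allI impI)
  fix \<mu> y assume \<mu>: "\<mu> \<in> Mset M p S" and y: "meas_bary M p \<mu> y"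
  show "y \<in> S"
  proof (rule ccontr)
    assume "y \<notin> S"
    moreover have "y \<in> Lp M p" using y by (simp add: meas_bary_def)
    ultimately obtain l \<delta> where l: "l \<in> Lp_dual M p" "\<delta> > 0" "\<And>f. f \<in> S \<Longrightarrow> l f \<le> l y - \<delta>"
      using Lp_separation[OF cl cvx ne] by metis
    obtain C where C: "C \<subseteq> S" "emeasure \<mu> C = 1" and "prob_space \<mu>"
      using \<mu> by (auto simp: Mset_def V_measure_def)
    interpret \<mu>: prob_space \<mu> by fact
    have int: "integrable \<mu> l" "l y = (\<integral>f. l f \<partial>\<mu>)" using y l(1) by (auto simp: meas_bary_def)
    have "AE f in \<mu>. f \<in> C" using C(2) by (intro \<mu>.AE_prob_1) (simp add: \<mu>.emeasure_eq_measure)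
    then have "AE f in \<mu>. l f \<le> l y - \<delta>" by eventually_elim (use C(1) l(3) in blast)
    then have "(\<integral>f. l f \<partial>\<mu>) \<le> (\<integral>f. l y - \<delta> \<partial>\<mu>)" by (intro integral_mono_AE int) simp
    then show False using int(2) l(2) by (simp add: \<mu>.prob_space)
  qed
qed

section \<open>Choquet sets are convex\<close>

lemma Lp_norm_eq_0_imp_AE:
  fixes f :: "'a \<Rightarrow> 'e::{banach,second_countable_topology}"
  assumes "f \<in> Lp M p" "Lp_norm M p f = 0"
  shows "AE w in M. f w = 0"
proof -
  have "(\<integral>w. norm (f w) powr p \<partial>M) = 0" using assms(2) Lp_norm_powr[of f] by simp
  then have "AE w in M. norm (f w) powr p = 0"
    using integral_nonneg_eq_0_iff_AE[OF Lp_integrable[OF assms(1)]] by simp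
  then show ?thesis by eventually_elim simp
qed

section \<open>Borel sets and continuous functionals of the seminormed space\<close>

lemma space_Lp_borel [simp]: "space (Lp_borel M p) = Lp M p"
  by (simp add: Lp_borel_def space_measure_of_conv)

lemma sets_Lp_borel:
  "sets (Lp_borel M p :: ('a \<Rightarrow> 'e::{banach,second_countable_topology}) measure)
    = sigma_sets (Lp M p) {U. openin (Lp_top M p) U}"
proof -
  have "{U. openin (Lp_top M p) U} \<subseteq> Pow (Lp M p :: ('a \<Rightarrow> 'e) set)"
    using openin_subset[of "Lp_top M p"] by auto
  then show ?thesis by (simp add: Lp_borel_def sets_measure_of)
qed

lemma openin_sets_Lp_borel: "openin (Lp_top M p) U \<Longrightarrow> U \<in> sets (Lp_borel M p)"
  by (simp add: sets_Lp_borel sigma_sets.Basic)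

lemma closedin_sets_Lp_borel:
  fixes S :: "('a \<Rightarrow> 'e::{banach,second_countable_topology}) set"
  assumes "closedin (Lp_top M p) S" shows "S \<in> sets (Lp_borel M p)"
proof -
  have "Lp M p - (Lp M p - S) \<in> sets (Lp_borel M p)"
    using assms sets.compl_sets[OF openin_sets_Lp_borel[of "Lp M p - S"]] by (simp add: closedin_def)
  then show ?thesis using closedin_Lp_subset[OF assms] by (simp add: double_diff)
qed

text \<open>Open sets are unions of classes of functions at distance 0, and this passes through
  complements, by symmetry of the distance, and through countable unions.\<close>

lemma Lp_borel_saturated:
  fixes B :: "('a \<Rightarrow> 'e::{banach,second_countable_topology}) set"
  assumes "B \<in> sets (Lp_borel M p)" "f \<in> B" "g \<in> Lp M p" "Lp_norm M p (f - g) = 0"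
  shows "g \<in> B"
  using assms(1)[unfolded sets_Lp_borel] assms(2-)
proof (induction arbitrary: f g)
  case (Basic U)
  then obtain e where "e > 0" "\<forall>g\<in>Lp M p. Lp_norm M p (f - g) < e \<longrightarrow> g \<in> U"
    unfolding mem_Collect_eq openin_Lp_top_iff by metis
  moreover from this(1) have "Lp_norm M p (f - g) < e" by (simp only: Basic.prems(3))
  ultimately show ?case using Basic.prems(2) by blast
next
  case (Compl B)
  have "Lp_norm M p (g - f) = 0" using Compl.prems(3) by (simp only: Lp_norm_minus_commute[of g f])
  then have "g \<in> B \<Longrightarrow> f \<in> B" using Compl.IH[of g f] Compl.prems(1) by blast
  then show ?case using Compl.prems(1,2) by blast
next
  case (Union a)
  then show ?case by blast
qed simp

text \<open>Points are functions rather than a.s.-classes, so singletons need not be Borel; the classes replace them.\<close>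

definition Lp_class :: "('a \<Rightarrow> 'e::{banach,second_countable_topology}) \<Rightarrow> ('a \<Rightarrow> 'e) set" where
  "Lp_class f = {g \<in> Lp M p. Lp_norm M p (f - g) = 0}"

lemma closedin_Lp_class:
  fixes f :: "'a \<Rightarrow> 'e::{banach,second_countable_topology}"
  assumes f: "f \<in> Lp M p" shows "closedin (Lp_top M p) (Lp_class f)"
proof (rule closedin_LpI)
  fix g :: "'a \<Rightarrow> 'e" assume g: "g \<in> Lp M p" and app: "\<And>e. e > 0 \<Longrightarrow> \<exists>h\<in>Lp_class f. Lp_norm M p (g - h) < e"
  have "Lp_norm M p (f - g) \<le> 0"
  proof (rule field_le_epsilon)
    fix e :: real assume "e > 0"
    then obtain h where h: "h \<in> Lp_class f" "Lp_norm M p (g - h) < e" using app by blast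
    then show "Lp_norm M p (f - g) \<le> 0 + e"
      using Lp_norm_diff_triangle[of f h g] f g Lp_norm_minus_commute[of g h] by (simp add: Lp_class_def)
  qed
  then show "g \<in> Lp_class f" using g Lp_norm_nonneg[of "f - g"] unfolding Lp_class_def by simp
qed (simp add: Lp_class_def)

text \<open>Any open set containing \<open>f\<close> contains its whole class, so one member of a
  cover suffices.\<close>

lemma compactin_Lp_class:
  fixes f :: "'a \<Rightarrow> 'e::{banach,second_countable_topology}"
  assumes f: "f \<in> Lp M p" shows "compactin (Lp_top M p) (Lp_class f)"
  unfolding compactin_def
proof (intro conjI allI impI)
  show "Lp_class f \<subseteq> topspace (Lp_top M p)" by (auto simp: Lp_class_def)
  fix \<U> assume U: "(\<forall>U\<in>\<U>. openin (Lp_top M p) U) \<and> Lp_class f \<subseteq> \<Union> \<U>"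
  have "f \<in> Lp_class f" using f by (simp add: Lp_class_def)
  then obtain U where "U \<in> \<U>" "f \<in> U" using U by blast
  moreover have "Lp_class f \<subseteq> U"
    using Lp_borel_saturated[OF openin_sets_Lp_borel _ _] U calculation by (auto simp: Lp_class_def)
  ultimately show "\<exists>\<F>. finite \<F> \<and> \<F> \<subseteq> \<U> \<and> Lp_class f \<subseteq> \<Union> \<F>" by (intro exI[of _ "{U}"]) auto
qed

lemma Lp_dual_linear:
  fixes f g :: "'a \<Rightarrow> 'e::{banach,second_countable_topology}"
  assumes "l \<in> Lp_dual M p" "f \<in> Lp M p" "g \<in> Lp M p"
  shows "l (a *\<^sub>R f + b *\<^sub>R g) = a * l f + b * l g"
proof -
  have "\<forall>f\<in>Lp M p. \<forall>g\<in>Lp M p. \<forall>a b. l (\<lambda>w. a *\<^sub>R f w + b *\<^sub>R g w) = a * l f + b * l g"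
    using assms(1) unfolding Lp_dual_def mem_Collect_eq by (rule conjunct1)
  from this[rule_format, OF assms(2,3), of a b]
  show ?thesis unfolding plus_fun_def scaleR_fun_def .
qed

lemma Lp_dual_diff:
  fixes f g :: "'a \<Rightarrow> 'e::{banach,second_countable_topology}"
  assumes "l \<in> Lp_dual M p" "f \<in> Lp M p" "g \<in> Lp M p"
  shows "l (f - g) = l f - l g"
  using Lp_dual_linear[OF assms, of 1 "-1"] by simp

lemma Lp_dual_measurable:
  fixes l :: "('a \<Rightarrow> 'e::{banach,second_countable_topology}) \<Rightarrow> real"
  assumes l: "l \<in> Lp_dual M p"
  shows "l \<in> borel_measurable (Lp_borel M p)"
proof (rule borel_measurableI)
  fix T :: "real set" assume T: "open T"
  obtain C where C: "\<And>f. f \<in> Lp M p \<Longrightarrow> \<bar>l f\<bar> \<le> C * Lp_norm M p f" using l unfolding Lp_dual_def by blast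
  \<comment> \<open>The constant \<open>C\<close> may be 0 or negative; a positive one is wanted as
    divisor of \<open>e\<close>.\<close>
  have C': "\<bar>l f\<bar> \<le> (\<bar>C\<bar> + 1) * Lp_norm M p f" if "f \<in> Lp M p" for f
  proof -
    have "C * Lp_norm M p f \<le> (\<bar>C\<bar> + 1) * Lp_norm M p f" by (intro mult_right_mono) auto
    then show ?thesis using C[OF that] by simp
  qed
  have "openin (Lp_top M p) {f \<in> Lp M p. l f \<in> T}"
    unfolding openin_Lp_top_iff
  proof (intro conjI ballI)
    fix f assume f: "f \<in> {f \<in> Lp M p. l f \<in> T}"
    then obtain e where e: "e > 0" "ball (l f) e \<subseteq> T" using T open_contains_ball by blast
    have "g \<in> {f \<in> Lp M p. l f \<in> T}" if g: "g \<in> Lp M p" "Lp_norm M p (f - g) < e / (\<bar>C\<bar> + 1)" for g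
    proof -
      have "\<bar>l f - l g\<bar> \<le> (\<bar>C\<bar> + 1) * Lp_norm M p (f - g)"
        using C'[OF Lp_diff[of f g]] Lp_dual_diff[OF l, of f g] f g by simp
      also have "\<dots> < e" using g(2) by (simp add: pos_less_divide_eq mult.commute)
      finally have "l g \<in> ball (l f) e" by (simp add: dist_real_def)
      then show ?thesis using e g by blast
    qed
    then show "\<exists>d>0. \<forall>g\<in>Lp M p. Lp_norm M p (f - g) < d \<longrightarrow> g \<in> {f \<in> Lp M p. l f \<in> T}"
      using e(1) by (intro exI[of _ "e / (\<bar>C\<bar> + 1)"]) auto
  qed auto
  then have "{f \<in> Lp M p. l f \<in> T} \<in> sets (Lp_borel M p)" by (rule openin_sets_Lp_borel)
  moreover have "l -` T \<inter> space (Lp_borel M p) = {f \<in> Lp M p. l f \<in> T}" by auto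
  ultimately show "l -` T \<inter> space (Lp_borel M p) \<in> sets (Lp_borel M p)" by (simp only:)
qed

lemma convex_choquet_set:
  fixes S :: "('a \<Rightarrow> 'e::{banach,second_countable_topology}) set"
  assumes S: "S \<in> Lp_sets M p" and ch: "choquet_set M p S"
  shows "convex S"
proof (rule convexI)
  fix f g :: "'a \<Rightarrow> 'e" and u v :: real
  assume fg: "f \<in> S" "g \<in> S" and uv: "0 \<le> u" "0 \<le> v" "u + v = 1"
  have L: "f \<in> Lp M p" "g \<in> Lp M p" using fg S by (auto simp: Lp_sets_def)
  define h where "h b = (if b then f else g)" for b
  have hL: "h b \<in> Lp M p" and hS: "h b \<in> S" for b using L fg by (auto simp: h_def)
  \<comment> \<open>The two-point measure with mass \<open>u\<close> at \<open>f\<close> and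
    \<open>v\<close> at \<open>g\<close>, as an image measure, so that masses and integrals are
    computed on \<open>bool\<close>.\<close>
  define \<mu> where "\<mu> = distr (measure_pmf (bernoulli_pmf u)) (Lp_borel M p) h"
  have hm: "h \<in> measurable (measure_pmf (bernoulli_pmf u)) (Lp_borel M p)" using hL by simp
  have em: "emeasure \<mu> B = emeasure (measure_pmf (bernoulli_pmf u)) (h -` B)" if "B \<in> sets (Lp_borel M p)" for B
    unfolding \<mu>_def using emeasure_distr[OF hm that] by simp
  have prob: "prob_space \<mu>" unfolding \<mu>_def by (rule prob_space.prob_space_distr[OF prob_space_measure_pmf hm])
  have cls: "Lp_class (h b) \<in> sets (Lp_borel M p)" for b
    by (rule closedin_sets_Lp_borel[OF closedin_Lp_class[OF hL]])
  have self: "h b \<in> Lp_class (h b)" for b using hL by (simp add: Lp_class_def)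
  have V: "V_measure M p \<mu>"
    unfolding V_measure_def
  proof (intro conjI ballI prob)
    show sets\<mu>: "sets \<mu> = sets (Lp_borel M p)" by (simp add: \<mu>_def)
    fix B assume "B \<in> sets \<mu>"
    then have B: "B \<in> sets (Lp_borel M p)" by (simp add: sets\<mu>)
    let ?\<C> = "{C \<in> sets \<mu>. C \<subseteq> B \<and> compactin (Lp_top M p) C}"
    \<comment> \<open>The classes of those atoms that lie in \<open>B\<close>: a compact Borel
      subset of \<open>B\<close> carrying all its mass, so the supremum in the regularity condition
      is attained.\<close>
    define C where "C = (\<Union>b\<in>{b. h b \<in> B}. Lp_class (h b))"
    have Cs: "C \<in> sets (Lp_borel M p)" unfolding C_def by (intro sets.finite_UN cls) auto
    have CB: "C \<subseteq> B" using Lp_borel_saturated[OF B] by (auto simp: C_def Lp_class_def)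
    have "compactin (Lp_top M p) C"
      unfolding C_def by (rule compactin_Union) (auto intro: compactin_Lp_class hL)
    then have "C \<in> ?\<C>" using Cs CB by (simp add: sets\<mu>)
    then have "emeasure \<mu> C \<le> (SUP C\<in>?\<C>. emeasure \<mu> C)" by (rule SUP_upper)
    moreover have "h -` C = h -` B" using CB self unfolding C_def by blast
    ultimately have "emeasure \<mu> B \<le> (SUP C\<in>?\<C>. emeasure \<mu> C)" by (simp add: em B Cs)
    moreover have "(SUP C\<in>?\<C>. emeasure \<mu> C) \<le> emeasure \<mu> B"
      using \<open>B \<in> sets \<mu>\<close> by (intro SUP_least emeasure_mono) auto
    ultimately show "emeasure \<mu> B = (SUP C\<in>?\<C>. emeasure \<mu> C)" by (rule antisym)
  qed
  have bary: "meas_bary M p \<mu> (u *\<^sub>R f + v *\<^sub>R g)"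
    unfolding meas_bary_def
  proof (intro conjI ballI Lp_convex_comb L)
    fix l :: "('a \<Rightarrow> 'e) \<Rightarrow> real" assume l: "l \<in> Lp_dual M p"
    have lm: "l \<in> borel_measurable (Lp_borel M p)" by (rule Lp_dual_measurable[OF l])
    show "integrable \<mu> l"
      unfolding \<mu>_def integrable_distr_eq[OF hm lm] by (rule integrable_measure_pmf_finite) simp
    have "(\<integral>f. l f \<partial>\<mu>) = (\<integral>b. l (h b) \<partial>measure_pmf (bernoulli_pmf u))"
      unfolding \<mu>_def by (rule integral_distr[OF hm lm])
    also have "\<dots> = u * l f + v * l g"
    proof -
      have "0 \<le> u" "u \<le> 1" "v = 1 - u" using uv by auto
      then show ?thesis by (simp add: h_def integral_bernoulli_pmf mult.commute)
    qed
    finally show "l (u *\<^sub>R f + v *\<^sub>R g) = (\<integral>f. l f \<partial>\<mu>)" by (simp only: Lp_dual_linear[OF l L])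
  qed
  \<comment> \<open>Since \<open>S\<close> is saturated, the two classes form a Borel subset of
    \<open>S\<close> of full mass, as \<open>Mset\<close> requires.\<close>
  have "Lp_class (h b) \<subseteq> S" for b
  proof
    fix k assume k: "k \<in> Lp_class (h b)"
    then have kL: "k \<in> Lp M p" by (simp add: Lp_class_def)
    have "Lp_norm M p (h b - k) = 0" using k unfolding Lp_class_def by blast
    from Lp_norm_eq_0_imp_AE[OF Lp_diff[OF hL kL] this] have "AE w in M. h b w = k w" by eventually_elim simp
    then show "k \<in> S" using S hS[of b] kL unfolding Lp_sets_def ae_closed_def by blast
  qed
  then have sub: "(\<Union>b. Lp_class (h b)) \<subseteq> S" by blast
  have Us: "(\<Union>b. Lp_class (h b)) \<in> sets (Lp_borel M p)" by (intro sets.finite_UN cls) auto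
  have "h -` (\<Union>b. Lp_class (h b)) = UNIV" using self by auto
  then have "emeasure \<mu> (\<Union>b. Lp_class (h b)) = 1"
    using em[OF Us] measure_pmf.emeasure_space_1[of "bernoulli_pmf u"] by simp
  then have "\<mu> \<in> Mset M p S" using V bary sub Us unfolding Mset_def by blast
  then show "u *\<^sub>R f + v *\<^sub>R g \<in> S" using ch bary unfolding choquet_set_def by blast
qed

section \<open>The hulls\<close>

context
  fixes A :: "('a \<Rightarrow> 'e::{banach,second_countable_topology}) set"
  assumes A: "A \<subseteq> Lp M p" "A \<noteq> {}"
begin

lemma Lp_cl_dec_convex_hull_props:
  "convex (Lp_cl M p (Lp_dec M (convex hull A)))" "decomposable M (Lp_cl M p (Lp_dec M (convex hull A)))"
  "closedin (Lp_top M p) (Lp_cl M p (Lp_dec M (convex hull A)))"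
  "convex hull A \<subseteq> Lp_cl M p (Lp_dec M (convex hull A))"
  using convex_hull_subset_Lp[OF A(1)]
  by (simp_all add: convex_Lp_cl_dec decomposable_Lp_cl_dec closedin_Lp_cl subset_Lp_cl_dec)

lemma subset_Lp_cl_dec_convex_hull: "A \<subseteq> Lp_cl M p (Lp_dec M (convex hull A))"
  using hull_subset[of A convex] Lp_cl_dec_convex_hull_props(4) by (rule order_trans)

lemma Lp_cl_dec_convex_hull_minimal:
  assumes "A \<subseteq> S" "convex S" "decomposable M S" "closedin (Lp_top M p) S"
  shows "Lp_cl M p (Lp_dec M (convex hull A)) \<subseteq> S"
  using assms hull_minimal[of A S convex] by (intro Lp_cl_dec_minimal) auto

text \<open>The Choquet hull is sandwiched between \<open>convex hull A\<close> and
  \<open>?D\<close>: each competitor in its definition is convex, and \<open>?D\<close> is one of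
  them. Both ends have the closed decomposable hull \<open>?D\<close>.\<close>

lemma chd_ch: "chd M p (ch M p A) = Lp_cl M p (Lp_dec M (convex hull A))" (is "_ = ?D")
proof -
  have "?D \<noteq> {}" using subset_Lp_cl_dec_convex_hull A(2) by blast
  then have "choquet_set M p ?D"
    using Lp_cl_dec_convex_hull_props by (intro choquet_set_closed_convex)
  then have 1: "ch M p A \<subseteq> ?D"
    unfolding ch_def using subset_Lp_cl_dec_convex_hull closedin_Lp_sets[OF Lp_cl_dec_convex_hull_props(3)]
    by (intro Inter_lower) simp
  have 2: "convex hull A \<subseteq> ch M p A"
    unfolding ch_def
  proof (rule Inter_greatest)
    fix S assume "S \<in> {S \<in> Lp_sets M p. A \<subseteq> S \<and> choquet_set M p S}"
    then show "convex hull A \<subseteq> S" by (intro hull_minimal) (auto intro: convex_choquet_set)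
  qed
  have L: "ch M p A \<subseteq> Lp M p" using 1 closedin_Lp_subset[OF Lp_cl_dec_convex_hull_props(3)] by (rule order_trans)
  have "convex hull A \<noteq> {}" using A(2) by simp
  then have ne: "ch M p A \<noteq> {}" using 2 by blast
  note Q = subset_Lp_cl_dec[OF L] decomposable_Lp_cl_dec[OF L] closedin_Lp_cl[of "Lp_dec M (ch M p A)"]
  have "Lp_cl M p (Lp_dec M (ch M p A)) \<subseteq> ?D"
    using 1 Lp_cl_dec_convex_hull_props by (intro Lp_cl_dec_minimal)
  moreover have "?D \<subseteq> Lp_cl M p (Lp_dec M (ch M p A))"
    using order_trans[OF 2 Q(1)] Q by (intro Lp_cl_dec_minimal)
  ultimately show ?thesis using chd_eq_Lp_cl_dec[OF L ne] by simp
qed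

text \<open>The selections of the pointwise hull form a closed, convex, decomposable set containing
  \<open>A\<close>, hence contain \<open>?D\<close>. The other inclusion is obtained
  pointwise.\<close>

lemma Lp_sel_closed_convex_hull:
  "Lp_sel M p (\<lambda>w. closure (convex hull (F_of M p A w))) = Lp_cl M p (Lp_dec M (convex hull A))" (is "?S = ?D")
proof (rule antisym)
  note F = F_of_props[OF A]
  have AF: "A \<subseteq> Lp_sel M p (F_of M p A)" using subset_Lp_cl_dec[OF A(1)] F(2) by simp
  have "F_of M p A w \<subseteq> closure (convex hull (F_of M p A w))" for w
    using hull_subset closure_subset by (rule order_trans)
  then have "Lp_sel M p (F_of M p A) \<subseteq> ?S" unfolding Lp_sel_def by (auto elim: eventually_mono)
  then have "A \<subseteq> ?S" using AF by blast
  then show "?D \<subseteq> ?S"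
    by (rule Lp_cl_dec_convex_hull_minimal)
      (auto intro!: convex_Lp_sel decomposable_Lp_sel closedin_Lp_sel convex_closure)
  \<comment> \<open>The set \<open>?D\<close> consists of the selections of the multifunction of
    \<open>H\<close>. Its values are a.s. closed, convex and contain those of
    \<open>F_of M p A\<close>, hence also contain their closed convex hulls.\<close>
  define H where "H = convex hull A"
  have H: "H \<subseteq> Lp M p" "H \<noteq> {}" using convex_hull_subset_Lp[OF A(1)] A(2) by (auto simp: H_def)
  note G = F_of_props[OF H]
  have D: "?D = Lp_sel M p (F_of M p H)" using G(2) by (simp add: H_def)
  have Gcl: "AE w in M. closed (F_of M p H w)" using G(1) by (auto simp: effros_closed_def intro: AE_I2)
  have "Lp_sel M p (F_of M p H) \<noteq> {}" using D subset_Lp_cl_dec_convex_hull A(2) by blast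
  then have Gcvx: "AE w in M. convex (F_of M p H w)"
    using Lp_cl_dec_convex_hull_props(1) D by (intro convex_selections_imp_convex G(1)) auto
  have "Lp_sel M p (F_of M p A) \<subseteq> Lp_sel M p (F_of M p H)"
    unfolding F(2) D[symmetric]
    by (rule Lp_cl_dec_minimal[OF subset_Lp_cl_dec_convex_hull Lp_cl_dec_convex_hull_props(2,3)])
  then have "AE w in M. F_of M p A w \<subseteq> F_of M p H w"
    using AF A(2) Gcl by (intro selections_subset_imp_subset F(1)) auto
  then have "AE w in M. closure (convex hull (F_of M p A w)) \<subseteq> F_of M p H w"
    using Gcl Gcvx by eventually_elim (intro closure_minimal hull_minimal)
  then show "?S \<subseteq> ?D" unfolding D Lp_sel_def by (auto elim: eventually_elim2)
qed

text \<open>Taking the two hulls in either order gives the least closed convex decomposable set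
  containing \<open>A\<close>, because each operation preserves the property produced by the
  other.\<close>

lemma Lp_cl_convex_hull_Lp_cl_dec:
  "Lp_cl M p (convex hull (Lp_cl M p (Lp_dec M A))) = Lp_cl M p (Lp_dec M (convex hull A))" (is "?K = ?D")
proof (rule antisym)
  let ?Q = "Lp_cl M p (Lp_dec M A)"
  have Q: "?Q \<subseteq> Lp M p" by (rule closedin_Lp_subset[OF closedin_Lp_cl])
  note hQ = convex_hull_subset_Lp[OF Q]
  have "?Q \<subseteq> ?D"
    by (rule Lp_cl_dec_minimal[OF subset_Lp_cl_dec_convex_hull Lp_cl_dec_convex_hull_props(2,3)])
  then show "?K \<subseteq> ?D" using Lp_cl_dec_convex_hull_props by (intro Lp_cl_convex_hull_minimal)
  show "?D \<subseteq> ?K"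
  proof (rule Lp_cl_dec_convex_hull_minimal)
    show "A \<subseteq> ?K"
      using subset_Lp_cl_dec[OF A(1)] hull_subset[of ?Q convex] Lp_cl_subset[OF hQ] by blast
    show "convex ?K" by (rule convex_Lp_cl[OF hQ convex_convex_hull])
    show "decomposable M ?K" by (rule decomposable_Lp_cl_convex_hull[OF Q decomposable_Lp_cl_dec[OF A(1)]])
  qed (rule closedin_Lp_cl)
qed

text \<open>A closed convex set containing all finite decompositions contains their closure
  too.\<close>

lemma Lp_cl_convex_hull_Lp_dec:
  "Lp_cl M p (convex hull (Lp_dec M A)) = Lp_cl M p (convex hull (Lp_cl M p (Lp_dec M A)))" (is "?K' = ?K")
proof (rule antisym)
  have d: "Lp_dec M A \<subseteq> Lp M p" by (rule Lp_dec_subset_Lp[OF A(1)])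
  note hd = convex_hull_subset_Lp[OF d]
  show "?K' \<subseteq> ?K" by (intro Lp_cl_mono hull_mono Lp_cl_subset d)
  have "Lp_dec M A \<subseteq> ?K'" using hull_subset Lp_cl_subset[OF hd] by (rule order_trans)
  then have "Lp_cl M p (Lp_dec M A) \<subseteq> ?K'" by (rule Lp_cl_minimal[OF _ closedin_Lp_cl])
  then show "?K \<subseteq> ?K'"
    by (rule Lp_cl_convex_hull_minimal[OF _ convex_Lp_cl[OF hd convex_convex_hull] closedin_Lp_cl])
qed

end

lemma choquet_set_chd_convex:
  fixes C :: "('a \<Rightarrow> 'e::{banach,second_countable_topology}) set"
  assumes C: "C \<subseteq> Lp M p" "C \<noteq> {}" and "convex C"
  shows "choquet_set M p (chd M p C)"
  unfolding chd_eq_Lp_cl_dec[OF C]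
proof (rule choquet_set_closed_convex[OF closedin_Lp_cl convex_Lp_cl_dec[OF C(1) \<open>convex C\<close>]])
  show "Lp_cl M p (Lp_dec M C) \<noteq> {}" using subset_Lp_cl_dec[OF C(1)] C(2) by blast
qed

end

theorem mainTheorem11:
  fixes M :: "'a measure" and p :: real
  assumes "prob_space M" and "complete_measure M" and "1 \<le> p"
  shows "(\<forall>C :: ('a \<Rightarrow> 'e::{banach,second_countable_topology}) set.
            C \<in> Lp_sets M p \<and> C \<noteq> {} \<and> Lp_convex C \<longrightarrow> choquet_set M p (chd M p C))
       \<and> (\<forall>A :: ('a \<Rightarrow> 'e) set. A \<in> Lp_sets M p \<and> A \<noteq> {} \<longrightarrow>
            chd M p (ch M p A) = chd M p (Lp_conv A)
          \<and> chd M p (Lp_conv A) = Lp_sel M p (\<lambda>w. closure (convex hull (F_of M p A w)))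
          \<and> Lp_sel M p (\<lambda>w. closure (convex hull (F_of M p A w)))
              = Lp_cl M p (Lp_conv (Lp_sel M p (F_of M p A)))
          \<and> Lp_cl M p (Lp_conv (Lp_sel M p (F_of M p A))) = Lp_cl M p (Lp_conv (chd M p A))
          \<and> Lp_cl M p (Lp_conv (chd M p A)) = Lp_cl M p (Lp_conv (Lp_dec M A))
          \<and> Lp_cl M p (Lp_conv (Lp_dec M A)) = Lp_cl M p (Lp_dec M (Lp_conv A)))"
proof -
  interpret prob_space M by fact
  interpret Lp_space M p by standard fact
  show ?thesis
    unfolding Lp_conv_eq_convex_hull Lp_convex_iff_convex
  proof (intro conjI[where P="All _"] allI impI, elim conjE)
    fix C :: "('a \<Rightarrow> 'e) set"
    assume "C \<in> Lp_sets M p" "C \<noteq> {}" "convex C"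
    then show "choquet_set M p (chd M p C)" by (intro choquet_set_chd_convex) (auto simp: Lp_sets_def)
  next
    fix A :: "('a \<Rightarrow> 'e) set" assume "A \<in> Lp_sets M p \<and> A \<noteq> {}"
    then have A: "A \<subseteq> Lp M p" "A \<noteq> {}" by (auto simp: Lp_sets_def)
    have "convex hull A \<noteq> {}" using A(2) by simp
    \<comment> \<open>Rewriting with these equations turns every member of the chain into
      \<open>Lp_cl M p (Lp_dec M (convex hull A))\<close>.\<close>
    note eqs = chd_ch[OF A] chd_eq_Lp_cl_dec[OF convex_hull_subset_Lp[OF A(1)] this]
      Lp_sel_closed_convex_hull[OF A] F_of_props(2)[OF A] chd_eq_Lp_cl_dec[OF A]
      Lp_cl_convex_hull_Lp_dec[OF A] Lp_cl_convex_hull_Lp_cl_dec[OF A]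
    show "chd M p (ch M p A) = chd M p (convex hull A)
          \<and> chd M p (convex hull A) = Lp_sel M p (\<lambda>w. closure (convex hull (F_of M p A w)))
          \<and> Lp_sel M p (\<lambda>w. closure (convex hull (F_of M p A w)))
              = Lp_cl M p (convex hull (Lp_sel M p (F_of M p A)))
          \<and> Lp_cl M p (convex hull (Lp_sel M p (F_of M p A))) = Lp_cl M p (convex hull (chd M p A))
          \<and> Lp_cl M p (convex hull (chd M p A)) = Lp_cl M p (convex hull (Lp_dec M A))
          \<and> Lp_cl M p (convex hull (Lp_dec M A)) = Lp_cl M p (Lp_dec M (convex hull A))"
      by (simp only: eqs simp_thms)
  qed
qed

end
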